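(* Let $h\ge 1$ be an integer and let $T$ be a binary tree of height $h$. Then $T$ has a $(\leq 3^{h-1}-1)$-subdivision $S$ with $\phi(S)\le 8$.
   Context: An anagram is a word of the form $WP$ where $W$ is a non-empty word and $P$ is a permutation of $W$ (a word whose letters form the same multiset as those of $W$). A vertex colouring of a graph is anagram-free if the sequence of colours along every path of the graph is not an anagram. The anagram-free chromatic number $\phi(G)$ of a graph $G$ is the minimum number of colours in an anagram-free colouring of $G$. A subdivision of $G$ is a graph obtained by replacing each edge $uv$ by a path with endpoints $u,v$; the internal vertices of these paths are division vertices, and the vertices of $G$ are original vertices. A $(\le k)$-subdivision is a subdivision in which every edge is subdivided at most $k$ times, i.e. receives at most $k$ division vertices. A binary tree is a rooted tree in which every vertex has at most $2$ children; its height is the maximum distance from the root to a vertex. *)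

theory Defs
  imports "Graph_Theory.Subdivision" "Graph_Theory.Vertex_Walk" "HOL-Library.Multiset"
begin

text \<open>
  Finite simple undirected graphs are \<^locale>\<open>pair_graph\<close>s: an edge \<open>uv\<close> is represented by the two
  arcs \<open>(u, v)\<close> and \<open>(v, u)\<close>. Paths are non-empty lists of distinct vertices (\<^const>\<open>vpath\<close>).
\<close>

section \<open>Anagram-free colourings\<close>

definition anagram :: "'c list \<Rightarrow> bool" where
  "anagram w \<longleftrightarrow> (\<exists>W P. w = W @ P \<and> W \<noteq> [] \<and> mset P = mset W)"

definition anagram_free_colouring :: "'a pair_pre_digraph \<Rightarrow> ('a \<Rightarrow> 'c) \<Rightarrow> bool" where
  "anagram_free_colouring G c \<longleftrightarrow> (\<forall>p. vpath p (with_proj G) \<longrightarrow> \<not> anagram (map c p))"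

text \<open>The minimum is taken over a non-empty set whenever \<open>G\<close> is finite, see below.\<close>

definition anagram_free_chromatic_number :: "'a pair_pre_digraph \<Rightarrow> nat" where
  "anagram_free_chromatic_number G =
    (LEAST k. \<exists>c :: 'a \<Rightarrow> nat. c ` pverts G \<subseteq> {..<k} \<and> anagram_free_colouring G c)"

lemma inj_on_imp_anagram_free_colouring:
  assumes "inj_on c (pverts G)"
  shows "anagram_free_colouring G c"
  unfolding anagram_free_colouring_def
proof (intro allI impI notI)
  fix p assume p: "vpath p (with_proj G)" and a: "anagram (map c p)"
  from p have "distinct p" "set p \<subseteq> pverts G"
    by (auto simp: vpath_def vwalk_def)
  with assms have d: "distinct (map c p)"
    by (auto simp: distinct_map intro: inj_on_subset)
  from a obtain W P where "map c p = W @ P" "W \<noteq> []" and m: "mset P = mset W"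
    by (auto simp: anagram_def)
  moreover from m have "set P = set W" by (rule mset_eq_setD)
  ultimately show False using d by (cases W) auto
qed

lemma anagram_free_chromatic_number_attained:
  assumes "finite (pverts G)"
  shows "\<exists>c :: 'a \<Rightarrow> nat. c ` pverts G \<subseteq> {..<anagram_free_chromatic_number (G :: 'a pair_pre_digraph)}
    \<and> anagram_free_colouring G c"
proof -
  obtain c :: "'a \<Rightarrow> nat" and n where "c ` pverts G = {i. i < n}" "inj_on c (pverts G)"
    using finite_imp_inj_to_nat_seg[OF assms] by blast
  then have "\<exists>k. \<exists>c :: 'a \<Rightarrow> nat. c ` pverts G \<subseteq> {..<k} \<and> anagram_free_colouring G c"
    by (metis inj_on_imp_anagram_free_colouring lessThan_def order_refl)
  then show ?thesis
    unfolding anagram_free_chromatic_number_def by (rule LeastI_ex)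
qed


section \<open>Subdivisions\<close>

text \<open>
  The list \<open>ds\<close> consists of the division vertices on the edge \<open>uv\<close>: a path of the subdivision \<open>H\<close> from
  \<open>u\<close> to \<open>v\<close> without original vertices in its interior can only be the path that replaces \<open>uv\<close>.
\<close>

definition le_subdivision :: "nat \<Rightarrow> 'a pair_pre_digraph \<Rightarrow> 'a pair_pre_digraph \<Rightarrow> bool" where
  "le_subdivision k G H \<longleftrightarrow> subdivision_pair G H \<and>
    (\<forall>(u, v) \<in> parcs G. \<exists>ds. vpath (u # ds @ [v]) (with_proj H) \<and> set ds \<inter> pverts G = {} \<and> length ds \<le> k)"

text \<open>
  \<^const>\<open>subdivision\<close> relates graphs over the same vertex type, which may be too small to provide
  the division vertices. Renaming the vertices of a graph embeds it into a larger type.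
\<close>

definition rename_verts :: "('a \<Rightarrow> 'b) \<Rightarrow> 'a pair_pre_digraph \<Rightarrow> 'b pair_pre_digraph" where
  "rename_verts f G = \<lparr>pverts = f ` pverts G, parcs = map_prod f f ` parcs G\<rparr>"


section \<open>Rooted binary trees\<close>

text \<open>
  \<^const>\<open>tree\<close> cannot be used for symmetric digraphs: the two arcs \<open>(u, v)\<close>, \<open>(v, u)\<close> of
  an edge already form a \<^const>\<open>pre_digraph.cycle\<close>. Cycles of undirected graphs have at least three
  vertices. Connectedness includes non-emptiness.
\<close>

definition undirected_cycle :: "'a pair_pre_digraph \<Rightarrow> 'a list \<Rightarrow> bool" where
  "undirected_cycle G p \<longleftrightarrow> 3 \<le> length p \<and> vpath p (with_proj G) \<and> (last p, hd p) \<in> parcs G"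

definition undirected_tree :: "'a pair_pre_digraph \<Rightarrow> bool" where
  "undirected_tree G \<longleftrightarrow> pair_graph G \<and> connected (with_proj G) \<and> (\<nexists>p. undirected_cycle G p)"

definition distance :: "'a pair_pre_digraph \<Rightarrow> 'a \<Rightarrow> 'a \<Rightarrow> nat" where
  "distance G u v =
    (LEAST n. \<exists>p. vpath p (with_proj G) \<and> hd p = u \<and> last p = v \<and> vwalk_length p = n)"

definition children :: "'a pair_pre_digraph \<Rightarrow> 'a \<Rightarrow> 'a \<Rightarrow> 'a set" where
  "children T r v = {w. (v, w) \<in> parcs T \<and> distance T r w = distance T r v + 1}"

definition binary_tree :: "'a pair_pre_digraph \<Rightarrow> 'a \<Rightarrow> bool" where
  "binary_tree T r \<longleftrightarrow>
    undirected_tree T \<and> r \<in> pverts T \<and> (\<forall>v \<in> pverts T. card (children T r v) \<le> 2)"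

definition tree_height :: "'a pair_pre_digraph \<Rightarrow> 'a \<Rightarrow> nat" where
  "tree_height T r = Max (distance T r ` pverts T)"

end

theory Submission
  imports Defs
begin

text \<open>
  Let \<open>w\<close> be Keranen's infinite word over four letters without abelian squares. Subdivide an edge from
  depth \<open>k\<close> to depth \<open>k + 1\<close> into a path of length \<open>3 ^ (h - 1 - k)\<close>. On edges to left children use the
  letters of \<open>w\<close>, on edges to right children a disjoint copy of them; on each downward path the colours
  of either side continue \<open>w\<close>. If the colours on a path form an anagram, so do the colours of one side,
  if there are any. On a downward path these form a factor of \<open>w\<close>, which is impossible. Let a path turn
  at \<open>u\<close>, where the two subdivided edges below \<open>u\<close> have length \<open>n\<close>. If it has at most \<open>n\<close> vertices below
  \<open>u\<close> on one branch, then the colours of the other side read like those of a downward path. Otherwise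
  it contains \<open>n\<close> vertices of the one side on the one branch and \<open>n\<close> vertices of the other side on the
  other branch, and fewer than \<open>n\<close> further vertices below each, so neither half of the anagram can lie
  within one branch; but one of them has to.

  That \<open>w\<close> has no abelian squares is shown by descent: the positions that delimit a square in the image
  of a word under Keranen's morphism can be rounded to boundaries of images of letters, which gives a
  square in the word itself unless the positions are within the image of two letters.
\<close>

section \<open>Keranen's word\<close>

lemma all_less_4: "(\<forall>c<4::nat. P c) \<longleftrightarrow> P 0 \<and> P 1 \<and> P 2 \<and> P 3"
  by (auto simp: numeral_eq_Suc less_Suc_eq)

lemma add_mod_4_cancel: "a < 4 \<Longrightarrow> b < 4 \<Longrightarrow> k < 4 \<Longrightarrow> (a + k) mod 4 = (b + k) mod 4 \<Longrightarrow> a = (b :: nat)"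
proof -
  have "\<forall>a<4. \<forall>b<4. \<forall>k<4::nat. (a + k) mod 4 = (b + k) mod 4 \<longrightarrow> a = b"
    by (simp add: all_less_4)
  then show "a < 4 \<Longrightarrow> b < 4 \<Longrightarrow> k < 4 \<Longrightarrow> (a + k) mod 4 = (b + k) mod 4 \<Longrightarrow> a = b" by blast
qed

lemma add_mod_4_eq_iff: "a < 4 \<Longrightarrow> c < 4 \<Longrightarrow> k < 4 \<Longrightarrow> (a + k) mod 4 = c \<longleftrightarrow> a = (c + 4 - k) mod (4 :: nat)"
proof -
  have "\<forall>a<4. \<forall>c<4. \<forall>k<4::nat. (a + k) mod 4 = c \<longleftrightarrow> a = (c + 4 - k) mod 4"
    by (simp add: all_less_4)
  then show "a < 4 \<Longrightarrow> c < 4 \<Longrightarrow> k < 4 \<Longrightarrow> (a + k) mod 4 = c \<longleftrightarrow> a = (c + 4 - k) mod 4" by blast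
qed

text \<open>The image of the letter \<open>0\<close> under Keranen's 85-uniform morphism. It begins
  and ends with \<open>0\<close>, so the image of any letter begins and ends with that
  letter.\<close>

definition keranen_image :: "nat list" where
  "keranen_image = 
   [0, 1, 2, 0, 2, 3, 2, 1, 2, 3, 2, 0, 3, 2, 3, 1, 3, 0, 1, 0, 2, 0, 1, 0, 3, 1, 0, 1, 2, 1, 3, 1, 2, 1, 0, 2,
    1, 2, 3, 2, 0, 2, 1, 0, 1, 3, 0, 1, 0, 2, 0, 3, 2, 1, 2, 3, 2, 0, 2, 3, 1, 2, 1, 0, 2, 1, 2, 3, 2, 0,
    2, 3, 2, 1, 3, 2, 3, 0, 3, 1, 3, 2, 1, 2, 0]"

lemma length_keranen_image [simp]: "length keranen_image = 85"
  by (simp add: keranen_image_def)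

lemma keranen_image_less: "i < 85 \<Longrightarrow> keranen_image ! i < 4"
proof -
  have "\<forall>x \<in> set keranen_image. x < 4" by (simp add: keranen_image_def)
  then show "i < 85 \<Longrightarrow> keranen_image ! i < 4" using nth_mem[of i keranen_image] by simp
qed

text \<open>
  The fixed point, starting with \<open>0\<close>, of the morphism that maps a letter \<open>x\<close> to \<^const>\<open>keranen_image\<close>
  shifted by \<open>x\<close> modulo 4: its \<open>n\<close>-th letter sums the letters selected by the base-85 digits of \<open>n\<close>.
\<close>

fun keranen :: "nat \<Rightarrow> nat" where
  "keranen n = (if n = 0 then 0 else (keranen_image ! (n mod 85) + keranen (n div 85)) mod 4)"

declare keranen.simps [simp del]

lemma keranen_rec:
  assumes "r < 85" shows "keranen (85 * q + r) = (keranen_image ! r + keranen q) mod 4"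
proof (cases "85 * q + r = 0")
  case True
  moreover have "keranen 0 = 0" "keranen_image ! 0 = 0" by (simp add: keranen.simps) (simp add: keranen_image_def)
  ultimately show ?thesis by simp
next
  case False
  then show ?thesis using assms by (subst keranen.simps) auto
qed

lemma keranen_less: "keranen n < 4"
  by (simp add: keranen.simps[of n])

text \<open>Where two images meet, the two letters are those of the preimage, which differ by
  induction; inside an image the neighbours come from \<open>keranen_image\<close> with one common
  shift.\<close>

lemma keranen_neq_Suc: "keranen n \<noteq> keranen (Suc n)"
proof (induction n rule: less_induct)
  case (less n)
  define q r where "q = n div 85" and "r = n mod 85"
  have n: "n = 85 * q + r" and "r < 85" by (auto simp: q_def r_def)
  show ?case
  proof (cases "r = 84")
    case True
    have "keranen_image ! 84 = 0" "keranen_image ! 0 = 0" by (simp_all add: keranen_image_def)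
    then have "keranen n = keranen q" "keranen (Suc n) = keranen (Suc q)"
      using keranen_rec[of 84 q] keranen_rec[of 0 "Suc q"] keranen_less[of q] keranen_less[of "Suc q"] True
      by (simp_all add: n)
    then show ?thesis using less[of q] True by (simp add: n)
  next
    case False
    then have "r < 84" using \<open>r < 85\<close> by simp
    have "list_all (\<lambda>i. keranen_image ! i \<noteq> keranen_image ! Suc i) [0..<84]"
      by code_simp
    then have "keranen_image ! r \<noteq> keranen_image ! Suc r" using \<open>r < 84\<close> by (auto simp: list_all_iff)
    moreover have "keranen_image ! r < 4" "keranen_image ! Suc r < 4" using keranen_image_less \<open>r < 84\<close> by auto
    moreover have "keranen n = (keranen_image ! r + keranen q) mod 4" "keranen (Suc n) = (keranen_image ! Suc r + keranen q) mod 4"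
      using keranen_rec[of r q] keranen_rec[of "Suc r" q] \<open>r < 84\<close> by (simp_all add: n)
    ultimately show ?thesis using keranen_less[of q] add_mod_4_cancel by metis
  qed
qed

section \<open>Letter counts of prefixes\<close>

definition letter_count :: "(nat \<Rightarrow> nat) \<Rightarrow> nat \<Rightarrow> nat \<Rightarrow> int" where
  "letter_count f p c = int (count_list (map f [0..<p]) c)"

lemma letter_count_0 [simp]: "letter_count f 0 c = 0"
  by (simp add: letter_count_def)

lemma letter_count_Suc: "letter_count f (Suc p) c = letter_count f p c + of_bool (f p = c)"
  by (simp add: letter_count_def)

lemma letter_count_add: "letter_count f (p + k) c = letter_count f p c + int (count_list (map f [p..<p + k]) c)"
  by (induction k) (auto simp: letter_count_Suc)

lemma letter_count_total:
  assumes "\<And>i. f i < 4" shows "letter_count f p 0 + letter_count f p 1 + letter_count f p 2 + letter_count f p 3 = int p"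
proof (induction p)
  case (Suc p)
  have "f p = 0 \<or> f p = 1 \<or> f p = 2 \<or> f p = 3" using assms[of p] by linarith
  then show ?case using Suc by (auto simp: letter_count_Suc)
qed simp

text \<open>A letter \<open>c\<close> in the image of \<open>x\<close> comes from a letter \<open>c - x\<close> of \<^const>\<open>keranen_image\<close>; adding 4 avoids truncation.\<close>

definition image_cnt :: "nat \<Rightarrow> nat \<Rightarrow> nat \<Rightarrow> int" where
  "image_cnt x r c = int (count_list (take r keranen_image) ((c + 4 - x) mod 4))"

lemma image_cnt_0 [simp]: "image_cnt x 0 c = 0"
  by (simp add: image_cnt_def)

lemma image_cnt_Suc:
  assumes "r < 85" shows "image_cnt x (Suc r) c = image_cnt x r c + of_bool (keranen_image ! r = (c + 4 - x) mod 4)"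
  using assms by (simp add: image_cnt_def take_Suc_conv_app_nth)

lemma image_cnt_85:
  "image_cnt 0 85 0 = 19" "image_cnt 0 85 1 = 21" "image_cnt 0 85 2 = 27" "image_cnt 0 85 3 = 18"
  "image_cnt 1 85 0 = 18" "image_cnt 1 85 1 = 19" "image_cnt 1 85 2 = 21" "image_cnt 1 85 3 = 27"
  "image_cnt 2 85 0 = 27" "image_cnt 2 85 1 = 18" "image_cnt 2 85 2 = 19" "image_cnt 2 85 3 = 21"
  "image_cnt 3 85 0 = 21" "image_cnt 3 85 1 = 27" "image_cnt 3 85 2 = 18" "image_cnt 3 85 3 = 19"
proof -
  have "count_list keranen_image 0 = 19" "count_list keranen_image 1 = 21" "count_list keranen_image 2 = 27" "count_list keranen_image 3 = 18"
    unfolding keranen_image_def by simp_all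
  then show
    "image_cnt 0 85 0 = 19" "image_cnt 0 85 1 = 21" "image_cnt 0 85 2 = 27" "image_cnt 0 85 3 = 18"
    "image_cnt 1 85 0 = 18" "image_cnt 1 85 1 = 19" "image_cnt 1 85 2 = 21" "image_cnt 1 85 3 = 27"
    "image_cnt 2 85 0 = 27" "image_cnt 2 85 1 = 18" "image_cnt 2 85 2 = 19" "image_cnt 2 85 3 = 21"
    "image_cnt 3 85 0 = 21" "image_cnt 3 85 1 = 27" "image_cnt 3 85 2 = 18" "image_cnt 3 85 3 = 19"
    by (simp_all add: image_cnt_def)
qed

text \<open>All shifts of the word satisfy the same recurrence, so one letter may be assumed to be \<open>0\<close>.\<close>

definition shifted :: "nat \<Rightarrow> nat \<Rightarrow> nat" where
  "shifted s n = (keranen n + s) mod 4"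

lemma shifted_less: "shifted s n < 4"
  by (simp add: shifted_def)

lemma shifted_rec: "r < 85 \<Longrightarrow> shifted s (85 * q + r) = (keranen_image ! r + shifted s q) mod 4"
  by (simp add: shifted_def keranen_rec mod_simps add.assoc)

lemma letter_count_shifted:
  assumes "s < 4" "c < 4" shows "letter_count (shifted s) p c = letter_count keranen p ((c + 4 - s) mod 4)"
proof (induction p)
  case (Suc p)
  have "shifted s p = c \<longleftrightarrow> keranen p = (c + 4 - s) mod 4"
    unfolding shifted_def using assms keranen_less[of p] by (intro add_mod_4_eq_iff)
  then show ?case using Suc by (simp add: letter_count_Suc)
qed simp

lemma letter_count_image:
  assumes "r \<le> 85" "c < 4"
  shows "letter_count (shifted s) (85 * q + r) c = letter_count (shifted s) (85 * q) c + image_cnt (shifted s q) r c"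
  using assms(1)
proof (induction r)
  case (Suc r)
  have "shifted s (85 * q + r) = c \<longleftrightarrow> keranen_image ! r = (c + 4 - shifted s q) mod 4"
    using Suc.prems assms(2) shifted_less[of s q] keranen_image_less[of r] add_mod_4_eq_iff
    by (metis shifted_rec Suc_le_eq)
  then show ?case using Suc by (simp add: letter_count_Suc image_cnt_Suc)
qed simp

text \<open>The prefix of length \<open>85 * q\<close> is the image of the prefix of length
  \<open>q\<close>, so its counts depend linearly on those of the latter.\<close>

lemma letter_count_images:
  assumes "c < 4"
  shows "letter_count (shifted s) (85 * q) c = letter_count (shifted s) q 0 * image_cnt 0 85 c + letter_count (shifted s) q 1 * image_cnt 1 85 c
    + letter_count (shifted s) q 2 * image_cnt 2 85 c + letter_count (shifted s) q 3 * image_cnt 3 85 c"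
proof (induction q)
  case (Suc q)
  have "shifted s q = 0 \<or> shifted s q = 1 \<or> shifted s q = 2 \<or> shifted s q = 3"
    using shifted_less[of s q] by linarith
  then show ?case
    using Suc letter_count_image[of 85 c s q] assms by (auto simp: letter_count_Suc algebra_simps)
qed simp

section \<open>Count vectors in a form fit for evaluation\<close>

type_synonym vec = "int \<times> int \<times> int \<times> int"

definition vec :: "(nat \<Rightarrow> int) \<Rightarrow> vec" where
  "vec F = (F 0, F 1, F 2, F 3)"

text \<open>Adding 1 modulo 4 to all letters of a word rotates its count vector, so the prefix
  vectors of one image yield those of all four.\<close>

fun rot :: "vec \<Rightarrow> vec" where
  "rot (a, b, c, d) = (d, a, b, c)"

lemma rot_image_cnt:
  "rot (vec (image_cnt 0 r)) = vec (image_cnt 1 r)"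
  "rot (vec (image_cnt 1 r)) = vec (image_cnt 2 r)"
  "rot (vec (image_cnt 2 r)) = vec (image_cnt 3 r)"
  by (simp_all add: vec_def image_cnt_def)

fun inc :: "nat \<Rightarrow> vec \<Rightarrow> vec" where
  "inc x (a, b, c, d) = (if x = 0 then (a + 1, b, c, d) else if x = 1 then (a, b + 1, c, d)
     else if x = 2 then (a, b, c + 1, d) else (a, b, c, d + 1))"

fun scan :: "vec \<Rightarrow> nat list \<Rightarrow> vec list" where
  "scan v [] = [v]"
| "scan v (x # xs) = v # scan (inc x v) xs"

lemma length_scan [simp]: "length (scan v xs) = Suc (length xs)"
  by (induction v xs rule: scan.induct) auto

lemma nth_scan:
  assumes "\<forall>x \<in> set xs. x < 4" "i \<le> length xs"
  shows "scan (vec (\<lambda>c. int (count_list ys c))) xs ! i = vec (\<lambda>c. int (count_list (ys @ take i xs) c))"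
  using assms
proof (induction xs arbitrary: ys i)
  case (Cons x xs)
  have "x = 0 \<or> x = 1 \<or> x = 2 \<or> x = 3" using Cons.prems by auto
  then have inc: "inc x (vec (\<lambda>c. int (count_list ys c))) = vec (\<lambda>c. int (count_list (ys @ [x]) c))"
    by (auto simp: vec_def)
  show ?case
  proof (cases i)
    case (Suc j)
    then show ?thesis using Cons.IH[of j "ys @ [x]"] Cons.prems by (simp only: scan.simps nth_Cons_Suc inc) simp
  qed simp
qed simp

lemma nth_scan_zero:
  assumes "\<forall>x \<in> set xs. x < 4" "i \<le> length xs"
  shows "scan (0, 0, 0, 0) xs ! i = vec (\<lambda>c. int (count_list (take i xs) c))"
  using nth_scan[OF assms, of "[]"] by (simp add: vec_def)

text \<open>
  The functions evaluated by \<open>code_simp\<close> use nested conditionals, because these are simplified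
  lazily, whereas both sides of a conjunction may be evaluated.
\<close>

fun balanced :: "vec \<Rightarrow> vec \<Rightarrow> vec \<Rightarrow> bool" where
  "balanced (a, b, c, d) (a', b', c', d') (a'', b'', c'', d'') =
     (if 2 * a' = a + a'' then if 2 * b' = b + b'' then if 2 * c' = c + c'' then 2 * d' = d + d''
      else False else False else False)"

lemma balanced_vec: "balanced (vec F) (vec G) (vec H) \<longleftrightarrow> (\<forall>c<4. 2 * G c = F c + H c)"
  by (auto simp: vec_def all_less_4)

subsection \<open>Abelian squares in images of two letters\<close>

text \<open>
  The middle prefix vector is \<open>v\<close>; the earlier ones are listed backwards and the later ones forwards,
  so that elements in the same place of the two lists have the same distance from it.
\<close>

fun no_square_centred :: "vec \<Rightarrow> vec list \<Rightarrow> vec list \<Rightarrow> bool" where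
  "no_square_centred v (l # ls) (r # rs) = (if balanced l v r then False else no_square_centred v ls rs)"
| "no_square_centred v [] rs = True"
| "no_square_centred v (l # ls) [] = True"

fun square_free :: "vec list \<Rightarrow> vec list \<Rightarrow> bool" where
  "square_free ls [] = True"
| "square_free ls (v # rs) = (if no_square_centred v ls rs then square_free (v # ls) rs else False)"

lemma no_square_centredD: "no_square_centred v ls rs \<Longrightarrow> i < length ls \<Longrightarrow> i < length rs \<Longrightarrow> \<not> balanced (ls ! i) v (rs ! i)"
proof (induction v ls rs arbitrary: i rule: no_square_centred.induct)
  case (1 v l ls r rs)
  then show ?case by (cases i) (auto split: if_splits)
qed auto

text \<open>\<open>rev ls @ rs\<close> remains the whole list of prefix vectors during the
  recursion, and \<open>length ls + i\<close> is the place of the centre in it.\<close>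

lemma square_freeD:
  "square_free ls rs \<Longrightarrow> i + Suc d < length rs \<Longrightarrow> d < i + length ls \<Longrightarrow> 
    \<not> balanced ((rev ls @ rs) ! (length ls + i - Suc d)) (rs ! i) (rs ! (i + Suc d))"
proof (induction ls rs arbitrary: i rule: square_free.induct)
  case (2 ls v rs)
  show ?case
  proof (cases i)
    case 0
    have d: "length ls - Suc d < length ls" using 2 0 by auto
    then have "(rev ls @ v # rs) ! (length ls + i - Suc d) = ls ! d"
      using 2 0 by (simp add: nth_append rev_nth)
    then show ?thesis using 2 0 no_square_centredD[of v ls rs d] by (auto split: if_splits)
  next
    case (Suc j)
    then show ?thesis using 2 "2.IH"[of j] by (auto split: if_splits)
  qed
qed auto

text \<open>A shift turns the first of two neighbouring letters into \<open>0\<close>; the second is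
  then not \<open>0\<close>, by \<open>keranen_neq_Suc\<close>, so three words cover all
  pairs.\<close>

lemma square_free_images_check:
  assumes "y \<in> {1, 2, 3}"
  shows "square_free [] (scan (0, 0, 0, 0) (keranen_image @ map (\<lambda>x. (x + y) mod 4) keranen_image))"
proof -
  have "square_free [] (scan (0, 0, 0, 0) (keranen_image @ map (\<lambda>x. (x + 1) mod 4) keranen_image))"
    by code_simp
  moreover have "square_free [] (scan (0, 0, 0, 0) (keranen_image @ map (\<lambda>x. (x + 2) mod 4) keranen_image))"
    by code_simp
  moreover have "square_free [] (scan (0, 0, 0, 0) (keranen_image @ map (\<lambda>x. (x + 3) mod 4) keranen_image))"
    by code_simp
  ultimately show ?thesis using assms by auto
qed

lemma no_square_images:
  assumes "y \<in> {1, 2, 3}" "u = keranen_image @ map (\<lambda>x. (x + y) mod 4) keranen_image"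
    and "i < j" "k \<le> 170" "2 * j = i + k"
  shows "\<exists>c<4. 2 * int (count_list (take j u) c) \<noteq> int (count_list (take i u) c) + int (count_list (take k u) c)"
proof -
  have "\<forall>x \<in> set u. x < 4" using keranen_image_less unfolding assms(2) by (auto simp: in_set_conv_nth)
  moreover have len: "length u = 170" by (simp add: assms(2))
  ultimately have nth: "scan (0, 0, 0, 0) u ! n = vec (\<lambda>c. int (count_list (take n u) c))" if "n \<le> 170" for n
    using that by (intro nth_scan_zero) auto
  define d where "d = j - i - 1"
  have k: "k = j + Suc d" and i: "i = j - Suc d" using assms by (auto simp: d_def)
  have "\<not> balanced (scan (0, 0, 0, 0) u ! i) (scan (0, 0, 0, 0) u ! j) (scan (0, 0, 0, 0) u ! k)"
    using square_freeD[OF square_free_images_check[OF assms(1), folded assms(2)], of j d] len assms(3-5)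
    unfolding k i by (simp add: d_def)
  then show ?thesis using nth[of i] nth[of j] nth[of k] assms(3-5) by (simp add: balanced_vec)
qed

subsection \<open>Carpi's criterion\<close>

type_synonym entry = "int \<times> int \<times> int \<times> int \<times> vec"

text \<open>
  The letter counts of the four images form a circulant matrix of determinant \<open>43435\<close>. Modulo this
  number, the coefficients below are the powers of a fourth root of unity and \<open>weight\<close> vanishes on
  the columns of the matrix, so it detects the integer vectors outside the lattice they span.
\<close>

fun weight :: "vec \<Rightarrow> int" where
  "weight (a, b, c, d) = a + 30176 * b + 19636 * c + 39101 * d"

definition residue :: "vec \<Rightarrow> int" where
  "residue v = weight v mod 43435"

text \<open>One residue for each of the four letters, computed once per offset, so that the search
  is a comparison of integers.\<close>

definition entry :: "vec \<Rightarrow> entry" where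
  "entry v = (residue v, residue (rot v), residue (rot (rot v)), residue (rot (rot (rot v))), v)"

fun vec_minus :: "vec \<Rightarrow> vec \<Rightarrow> vec" where
  "vec_minus (a, b, c, d) (a', b', c', d') = (a - a', b - b', c - c', d - d')"

definition image_vec :: vec where "image_vec = (19, 21, 27, 18)"

text \<open>Subtraction modulo 43435 of reduced numbers. Applied to twice the middle residue and to
  the left residue, it gives the residue required on the right.\<close>

fun complement :: "int \<Rightarrow> int \<Rightarrow> int" where
  "complement c p = (if p \<le> c then c - p else c + 43435 - p)"

text \<open>
  Carpi's criterion: whenever the lattice admits an abelian square whose three positions lie \<open>l\<close>, \<open>v\<close>
  and \<open>r\<close> into the images of three letters, each position can be rounded to the start or to the end
  of its image such that the boundaries are again balanced. The primed vectors belong to the ends.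
\<close>

fun balanced_up_to :: "vec \<Rightarrow> vec \<Rightarrow> vec \<Rightarrow> vec \<Rightarrow> vec \<Rightarrow> vec \<Rightarrow> bool" where
  "balanced_up_to l l' v v' r r' = (if balanced l v r then True else if balanced l' v r then True else
     if balanced l v r' then True else if balanced l' v r' then True else
     if balanced l v' r then True else if balanced l' v' r then True else
     if balanced l v' r' then True else balanced l' v' r')"

text \<open>The middle letter is \<open>0\<close> after a shift; \<open>fl\<close> and
  \<open>fr\<close> are the counts of the whole outer images. Rounding down subtracts an offset
  vector from a count, rounding up subtracts its difference with the whole image, so balanced
  corrections turn a square into balanced boundaries.\<close>

definition roundable :: "vec \<Rightarrow> vec \<Rightarrow> vec \<Rightarrow> vec \<Rightarrow> vec \<Rightarrow> bool" where
  "roundable v l fl r fr = balanced_up_to l (vec_minus l fl) v (vec_minus v image_vec) r (vec_minus r fr)"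

text \<open>\<open>t\<close> is the residue that the right vector must have. A rotation with another
  residue cannot complete a square, so rounding is tested only on agreement.\<close>

fun cell :: "vec \<Rightarrow> int \<Rightarrow> vec \<Rightarrow> vec \<Rightarrow> entry \<Rightarrow> bool" where
  "cell v t l fl (p0, p1, p2, p3, r) =
    (if (if t = p0 then roundable v l fl r image_vec else True)
     then if (if t = p1 then roundable v l fl (rot r) (rot image_vec) else True)
     then if (if t = p2 then roundable v l fl (rot (rot r)) (rot (rot image_vec)) else True)
     then (if t = p3 then roundable v l fl (rot (rot (rot r))) (rot (rot (rot image_vec))) else True)
     else False else False else False)"

fun cells :: "vec \<Rightarrow> int \<Rightarrow> entry \<Rightarrow> entry \<Rightarrow> bool" where
  "cells v c (p0, p1, p2, p3, l) e =
    (if cell v (complement c p0) l image_vec e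
     then if cell v (complement c p1) (rot l) (rot image_vec) e
     then if cell v (complement c p2) (rot (rot l)) (rot (rot image_vec)) e
     then cell v (complement c p3) (rot (rot (rot l))) (rot (rot (rot image_vec))) e
     else False else False else False)"

fun row :: "vec \<Rightarrow> int \<Rightarrow> entry list \<Rightarrow> entry list \<Rightarrow> bool" where
  "row v c (e # es) (f # fs) = (if cells v c e f then row v c es fs else False)"
| "row v c [] fs = True"
| "row v c (e # es) [] = True"

fun row_of :: "entry list \<Rightarrow> entry list \<Rightarrow> entry \<Rightarrow> bool" where
 "row_of es fs (p0, p1, p2, p3, v) = row v (2 * p0 mod 43435) es fs"

text \<open>Dropping aligns the offset \<open>i\<close> with the offset congruent to \<open>2 * r - i\<close> modulo 85.\<close>

definition carpi_row :: "nat \<Rightarrow> entry list \<Rightarrow> bool" where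
  "carpi_row r es = row_of es (drop ((169 - 2 * r) mod 85) (rev es @ rev es)) (es ! r)"

fun carpi_rows :: "nat list \<Rightarrow> entry list \<Rightarrow> bool" where
  "carpi_rows [] es = True"
| "carpi_rows (r # rs) es = (if carpi_row r es then carpi_rows rs es else False)"

text \<open>\<open>butlast\<close> drops the vector of the whole image, since offset 85 is offset 0
  of the next image.\<close>

definition prefix_table :: "entry list" where
  "prefix_table = map entry (butlast (scan (0, 0, 0, 0) keranen_image))"

lemma carpi_check_lower: "carpi_rows [0..<43] prefix_table"
  by code_simp

lemma carpi_check_upper: "carpi_rows [43..<85] prefix_table"
  by code_simp

lemma length_prefix_table [simp]: "length prefix_table = 85"
  by (simp add: prefix_table_def)

lemma nth_prefix_table:
  assumes "r < 85" shows "prefix_table ! r = entry (vec (image_cnt 0 r))"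
proof -
  have "\<forall>x \<in> set keranen_image. x < 4" using keranen_image_less by (auto simp: in_set_conv_nth)
  then have "scan (0, 0, 0, 0) keranen_image ! r = vec (\<lambda>c. int (count_list (take r keranen_image) c))"
    using assms by (intro nth_scan_zero) auto
  also have "\<dots> = vec (image_cnt 0 r)" by (simp add: vec_def image_cnt_def)
  finally show ?thesis using assms by (simp add: prefix_table_def nth_butlast)
qed

lemma rowD: "row v c es fs \<Longrightarrow> i < length es \<Longrightarrow> i < length fs \<Longrightarrow> cells v c (es ! i) (fs ! i)"
proof (induction v c es fs arbitrary: i rule: row.induct)
  case (1 v c e es f fs)
  then show ?case by (cases i) (auto split: if_splits)
qed auto

lemma carpi_rowsD: "carpi_rows rs es \<Longrightarrow> r \<in> set rs \<Longrightarrow> carpi_row r es"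
  by (induction rs) (auto split: if_splits)

lemma carpi_cells:
  assumes "r0 < 85" "r1 < 85" "r2 < 85" "(r0 + r2) mod 85 = 2 * r1 mod 85"
  shows "cells (vec (image_cnt 0 r1)) (2 * residue (vec (image_cnt 0 r1)) mod 43435)
    (entry (vec (image_cnt 0 r0))) (entry (vec (image_cnt 0 r2)))"
proof -
  define k where "k = (169 - 2 * r1) mod 85"
  have "carpi_row r1 prefix_table"
  proof (cases "r1 < 43")
    case True
    then show ?thesis by (intro carpi_rowsD[OF carpi_check_lower]) (simp del: upt.simps upt_rec_numeral)
  next
    case False
    then show ?thesis using assms(2)
      by (intro carpi_rowsD[OF carpi_check_upper]) (simp del: upt.simps upt_rec_numeral)
  qed
  then have row: "row (vec (image_cnt 0 r1)) (2 * residue (vec (image_cnt 0 r1)) mod 43435)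
      prefix_table (drop k (rev prefix_table @ rev prefix_table))"
    using assms(2) by (simp add: carpi_row_def nth_prefix_table entry_def k_def)
  have k: "k < 85" by (simp add: k_def)
  \<comment> \<open>Place \<open>k + r0\<close> of the doubled reversed table carries offset
    \<open>84 - k - r0\<close> modulo 85; this congruence makes that offset
    \<open>r2\<close>.\<close>
  have "(k + 2 * r1) mod 85 = 84"
    using assms(2) by (simp add: k_def mod_simps)
  then have mod: "(k + (r0 + r2)) mod 85 = 84" using mod_add_cong[OF refl assms(4), of k] by simp
  have "n = 84 \<or> n = 169" if "n mod 85 = 84" "n < 254" for n :: nat
    using that by presburger
  from this[OF mod] have "k + r0 + r2 = 84 \<or> k + r0 + r2 = 169" using k assms by linarith
  then have "drop k (rev prefix_table @ rev prefix_table) ! r0 = prefix_table ! r2"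
    using k assms by (auto simp: nth_append rev_nth add.commute intro!: arg_cong[where f = "\<lambda>i. prefix_table ! i"])
  then show ?thesis
    using rowD[OF row, of r0] k assms by (simp add: nth_prefix_table)
qed

lemma complement_mod:
  assumes "0 \<le> u" "u < 43435" "0 \<le> v" "v < 43435"
  shows "complement u v = (u - v) mod 43435"
proof (cases "v \<le> u")
  case False
  then have "(u - v + 43435) mod 43435 = u - v + 43435" using assms by (intro mod_pos_pos_trivial) auto
  then show ?thesis using False by simp
qed (use assms in \<open>simp add: mod_pos_pos_trivial\<close>)

lemma complement_residue:
  assumes "43435 dvd 2 * b - a - (c :: int)"
  shows "complement (2 * (b mod 43435) mod 43435) (a mod 43435) = c mod 43435"
proof -
  have "complement (2 * (b mod 43435) mod 43435) (a mod 43435) =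
    (2 * (b mod 43435) mod 43435 - a mod 43435) mod 43435"
    by (intro complement_mod) simp_all
  also have "\<dots> = (2 * b - a) mod 43435" by (simp only: mod_simps)
  also have "\<dots> = c mod 43435" using assms by (simp only: mod_eq_dvd_iff)
  finally show ?thesis .
qed

lemma cell_iff: "cell v t l fl (p0, p1, p2, p3, r) \<longleftrightarrow>
  (t = p0 \<longrightarrow> roundable v l fl r image_vec) \<and> (t = p1 \<longrightarrow> roundable v l fl (rot r) (rot image_vec)) \<and>
  (t = p2 \<longrightarrow> roundable v l fl (rot (rot r)) (rot (rot image_vec))) \<and>
  (t = p3 \<longrightarrow> roundable v l fl (rot (rot (rot r))) (rot (rot (rot image_vec))))"
  by simp

lemma cells_iff: "cells v c (p0, p1, p2, p3, l) e \<longleftrightarrow>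
  cell v (complement c p0) l image_vec e \<and> cell v (complement c p1) (rot l) (rot image_vec) e \<and>
  cell v (complement c p2) (rot (rot l)) (rot (rot image_vec)) e \<and>
  cell v (complement c p3) (rot (rot (rot l))) (rot (rot (rot image_vec))) e"
  by (simp del: cell.simps complement.simps)

lemma image_vec_eq: "image_vec = vec (image_cnt 0 85)"
  by (simp add: image_vec_def vec_def image_cnt_85 flip: One_nat_def)

lemma carpi_roundable:
  assumes "r0 < 85" "r1 < 85" "r2 < 85" "(r0 + r2) mod 85 = 2 * r1 mod 85"
    and "x0 < 4" "x2 < 4"
    and dvd: "43435 dvd 2 * weight (vec (image_cnt 0 r1)) - weight (vec (image_cnt x0 r0)) - weight (vec (image_cnt x2 r2))"
  shows "roundable (vec (image_cnt 0 r1)) (vec (image_cnt x0 r0)) (vec (image_cnt x0 85))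
    (vec (image_cnt x2 r2)) (vec (image_cnt x2 85))"
proof -
  have t: "complement (2 * residue (vec (image_cnt 0 r1)) mod 43435) (residue (vec (image_cnt x0 r0))) =
      residue (vec (image_cnt x2 r2))"
    unfolding residue_def by (rule complement_residue[OF dvd])
  have "x0 = 0 \<or> x0 = 1 \<or> x0 = 2 \<or> x0 = 3" "x2 = 0 \<or> x2 = 1 \<or> x2 = 2 \<or> x2 = 3"
    using assms(5,6) by linarith+
  then show ?thesis
    using carpi_cells[OF assms(1-4)] t
    by (elim disjE) (simp_all only: entry_def cells_iff cell_iff rot_image_cnt image_vec_eq)
qed

lemma vec_minus_vec: "vec_minus (vec F) (vec G) = vec (\<lambda>c. F c - G c)"
  by (simp add: vec_def)

lemma ex_le_1: "(\<exists>a\<le>1. P a) \<longleftrightarrow> P 0 \<or> P (1 :: nat)"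
  by (auto simp: le_Suc_eq)

text \<open>A value \<open>0\<close> of \<open>a0\<close>, \<open>a1\<close> or \<open>a2\<close>
  rounds to the start of the image, \<open>1\<close> to its end; the eight choices are those of
  \<open>balanced_up_to\<close>.\<close>

lemma carpi:
  assumes "r0 < 85" "r1 < 85" "r2 < 85" "(r0 + r2) mod 85 = 2 * r1 mod 85"
    and "x0 < 4" "x2 < 4"
    and "43435 dvd 2 * weight (vec (image_cnt 0 r1)) - weight (vec (image_cnt x0 r0)) - weight (vec (image_cnt x2 r2))"
  shows "\<exists>a0 \<le> 1. \<exists>a1 \<le> 1. \<exists>a2 \<le> 1. \<forall>c<4. 2 * (image_cnt 0 r1 c - int a1 * image_cnt 0 85 c) =
    (image_cnt x0 r0 c - int a0 * image_cnt x0 85 c) + (image_cnt x2 r2 c - int a2 * image_cnt x2 85 c)"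
proof -
  let ?B = "\<lambda>a0 a1 a2. \<forall>c<4. 2 * (image_cnt 0 r1 c - int a1 * image_cnt 0 85 c) =
    (image_cnt x0 r0 c - int a0 * image_cnt x0 85 c) + (image_cnt x2 r2 c - int a2 * image_cnt x2 85 c)"
  have "?B 0 0 0 \<or> ?B 1 0 0 \<or> ?B 0 0 1 \<or> ?B 1 0 1 \<or> ?B 0 1 0 \<or> ?B 1 1 0 \<or> ?B 0 1 1 \<or> ?B 1 1 1"
    using carpi_roundable[OF assms]
    by (simp add: roundable_def image_vec_eq vec_minus_vec balanced_vec split: if_splits)
  then show ?thesis unfolding ex_le_1 by argo
qed

subsection \<open>Descent\<close>

text \<open>For \<open>p0 < p1 < p2\<close>: the factors between consecutive positions form an abelian square.\<close>

definition square :: "(nat \<Rightarrow> nat) \<Rightarrow> nat \<Rightarrow> nat \<Rightarrow> nat \<Rightarrow> bool" where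
  "square f p0 p1 p2 \<longleftrightarrow> (\<forall>c<4. 2 * letter_count f p1 c = letter_count f p0 c + letter_count f p2 c)"

lemma square_shifted:
  assumes "s < 4" shows "square (shifted s) p0 p1 p2 \<longleftrightarrow> square keranen p0 p1 p2"
proof
  assume "square keranen p0 p1 p2"
  then show "square (shifted s) p0 p1 p2" using assms by (simp add: square_def letter_count_shifted)
next
  assume *: "square (shifted s) p0 p1 p2"
  show "square keranen p0 p1 p2"
    unfolding square_def
  proof (intro allI impI)
    fix c :: nat assume "c < 4"
    then have "((c + s) mod 4 + 4 - s) mod 4 = c"
      using add_mod_4_eq_iff[of c "(c + s) mod 4" s] assms by simp
    then show "2 * letter_count keranen p1 c = letter_count keranen p0 c + letter_count keranen p2 c"
      using * assms letter_count_shifted[of s "(c + s) mod 4"] unfolding square_def by (metis mod_less_divisor zero_less_numeral)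
  qed
qed

text \<open>Summing over the four letters turns counts into lengths.\<close>

lemma square_length:
  assumes "square (shifted s) p0 p1 p2" shows "2 * p1 = p0 + p2"
proof -
  have "2 * int p1 = int p0 + int p2"
    using assms unfolding square_def all_less_4
      letter_count_total[of "shifted s", OF shifted_less, symmetric] by (elim conjE) (simp only: algebra_simps)
  then show ?thesis by linarith
qed

lemma shift_to_zero: "\<exists>s<4. shifted s n = 0"
proof -
  have "shifted ((4 - keranen n) mod 4) n = 0"
    using keranen_less[of n] by (cases "keranen n = 0") (simp_all add: shifted_def)
  then show ?thesis by (intro exI[of _ "(4 - keranen n) mod 4"]) auto
qed

text \<open>The defect \<open>z\<close> is sent to zero by the count matrix of the images, which is
  nonsingular.\<close>

lemma square_images_reflect:
  assumes "\<forall>c<4. 2 * letter_count (shifted s) (85 * q1) c = letter_count (shifted s) (85 * q0) c + letter_count (shifted s) (85 * q2) c"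
  shows "square (shifted s) q0 q1 q2"
proof -
  define z where "z c = 2 * letter_count (shifted s) q1 c - letter_count (shifted s) q0 c - letter_count (shifted s) q2 c" for c
  have "z 0 * image_cnt 0 85 c + z 1 * image_cnt 1 85 c + z 2 * image_cnt 2 85 c + z 3 * image_cnt 3 85 c = 0"
    if "c < 4" for c
    using assms[rule_format, OF that] unfolding letter_count_images[OF that] z_def by (simp add: algebra_simps)
  from this[of 0] this[of 1] this[of 2] this[of 3]
  have "z 0 * 19 + z 1 * 18 + z 2 * 27 + z 3 * 21 = 0" "z 0 * 21 + z 1 * 19 + z 2 * 18 + z 3 * 27 = 0"
    "z 0 * 27 + z 1 * 21 + z 2 * 19 + z 3 * 18 = 0" "z 0 * 18 + z 1 * 27 + z 2 * 21 + z 3 * 19 = 0"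
    by (simp_all only: image_cnt_85)
  then have "z 0 = 0" "z 1 = 0" "z 2 = 0" "z 3 = 0" by linarith+
  then show ?thesis by (auto simp: square_def all_less_4 z_def)
qed

text \<open>One step of the descent. The defect of the offset vectors is an integer combination of
  the count vectors of whole images, so its weight is a multiple of 43435 and \<open>carpi\<close>
  finds a rounding. The balanced boundaries pull back by
  \<open>square_images_reflect\<close>.\<close>

lemma square_round:
  assumes "square keranen (85 * q0 + r0) (85 * q1 + r1) (85 * q2 + r2)" "r0 < 85" "r1 < 85" "r2 < 85"
  shows "\<exists>a0 \<le> 1. \<exists>a1 \<le> 1. \<exists>a2 \<le> 1. square keranen (q0 + a0) (q1 + a1) (q2 + a2)"
proof -
  obtain s where s: "s < 4" "shifted s q1 = 0" using shift_to_zero by blast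
  define x0 x2 where "x0 = shifted s q0" and "x2 = shifted s q2"
  define z where "z c = 2 * letter_count (shifted s) q1 c - letter_count (shifted s) q0 c - letter_count (shifted s) q2 c" for c
  have sq: "square (shifted s) (85 * q0 + r0) (85 * q1 + r1) (85 * q2 + r2)"
    using assms(1) s(1) by (simp add: square_shifted)
  have eq: "2 * (letter_count (shifted s) (85 * q1) c + image_cnt 0 r1 c) =
      (letter_count (shifted s) (85 * q0) c + image_cnt x0 r0 c) + (letter_count (shifted s) (85 * q2) c + image_cnt x2 r2 c)"
    if "c < 4" for c
    using sq that assms s(2) by (simp add: square_def letter_count_image x0_def x2_def)
  have "2 * (85 * q1 + r1) = 85 * q0 + r0 + (85 * q2 + r2)" by (rule square_length[OF sq])
  then have "(r0 + r2 + 85 * (q0 + q2)) mod 85 = (2 * r1 + 85 * (2 * q1)) mod 85" by (simp add: algebra_simps)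
  then have len: "(r0 + r2) mod 85 = 2 * r1 mod 85" by (simp only: mod_mult_self2)
  have diff: "2 * image_cnt 0 r1 c - image_cnt x0 r0 c - image_cnt x2 r2 c =
      - (z 0 * image_cnt 0 85 c + z 1 * image_cnt 1 85 c + z 2 * image_cnt 2 85 c + z 3 * image_cnt 3 85 c)"
    if "c < 4" for c
    using eq[OF that] unfolding letter_count_images[OF that] z_def by (simp add: algebra_simps)
  have "(0::nat) < 4" "(1::nat) < 4" "(2::nat) < 4" "(3::nat) < 4" by simp_all
  note diff' = this[THEN diff]
  have "2 * weight (vec (image_cnt 0 r1)) - weight (vec (image_cnt x0 r0)) - weight (vec (image_cnt x2 r2)) =
    (2 * image_cnt 0 r1 0 - image_cnt x0 r0 0 - image_cnt x2 r2 0)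
    + 30176 * (2 * image_cnt 0 r1 1 - image_cnt x0 r0 1 - image_cnt x2 r2 1)
    + 19636 * (2 * image_cnt 0 r1 2 - image_cnt x0 r0 2 - image_cnt x2 r2 2)
    + 39101 * (2 * image_cnt 0 r1 3 - image_cnt x0 r0 3 - image_cnt x2 r2 3)"
    by (simp add: vec_def)
  also have "\<dots> = - (z 0 * weight (vec (image_cnt 0 85)) + z 1 * weight (vec (image_cnt 1 85))
       + z 2 * weight (vec (image_cnt 2 85)) + z 3 * weight (vec (image_cnt 3 85)))"
    unfolding diff' by (simp add: vec_def algebra_simps)
  finally have "2 * weight (vec (image_cnt 0 r1)) - weight (vec (image_cnt x0 r0)) - weight (vec (image_cnt x2 r2)) =
    - (z 0 * weight (vec (image_cnt 0 85)) + z 1 * weight (vec (image_cnt 1 85))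
       + z 2 * weight (vec (image_cnt 2 85)) + z 3 * weight (vec (image_cnt 3 85)))" .
  moreover have "43435 dvd weight (vec (image_cnt 0 85))" "43435 dvd weight (vec (image_cnt 1 85))"
    "43435 dvd weight (vec (image_cnt 2 85))" "43435 dvd weight (vec (image_cnt 3 85))"
    unfolding vec_def image_cnt_85 by simp_all
  ultimately have dvd: "43435 dvd 2 * weight (vec (image_cnt 0 r1)) - weight (vec (image_cnt x0 r0)) - weight (vec (image_cnt x2 r2))"
    by (simp add: dvd_add dvd_mult del: weight.simps)
  have x: "x0 < 4" "x2 < 4" by (auto simp: x0_def x2_def shifted_less)
  obtain a0 a1 a2 where a: "a0 \<le> 1" "a1 \<le> 1" "a2 \<le> 1"
    and bal: "\<forall>c<4. 2 * (image_cnt 0 r1 c - int a1 * image_cnt 0 85 c) =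
      (image_cnt x0 r0 c - int a0 * image_cnt x0 85 c) + (image_cnt x2 r2 c - int a2 * image_cnt x2 85 c)"
    using carpi[OF assms(2-4) len x dvd] by blast
  have up: "letter_count (shifted s) (85 * (q + a)) c = letter_count (shifted s) (85 * q) c + int a * image_cnt (shifted s q) 85 c"
    if "a \<le> 1" "c < 4" for q a c
    using that letter_count_image[of 85 c s q] by (cases a) (simp_all add: algebra_simps)
  have "2 * letter_count (shifted s) (85 * (q1 + a1)) c = letter_count (shifted s) (85 * (q0 + a0)) c + letter_count (shifted s) (85 * (q2 + a2)) c"
    if "c < 4" for c
    using eq[OF that] bal[rule_format, OF that] up[OF a(1) that, of q0] up[OF a(2) that, of q1] up[OF a(3) that, of q2]
    unfolding s(2) x0_def x2_def by algebra
  then have "square (shifted s) (q0 + a0) (q1 + a1) (q2 + a2)"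
    by (intro square_images_reflect) auto
  then show ?thesis using a s(1) by (auto simp: square_shifted)
qed

text \<open>All positions lie in two adjacent images, which after a shift form the word
  \<open>u\<close> of the finite check.\<close>

lemma no_square_near:
  assumes "p0 < p1" "85 * m \<le> p0" "p2 \<le> 85 * m + 170"
  shows "\<not> square keranen p0 p1 p2"
proof
  assume sq: "square keranen p0 p1 p2"
  obtain s where s: "s < 4" "shifted s m = 0" using shift_to_zero by blast
  define y u where "y = shifted s (Suc m)" and "u = keranen_image @ map (\<lambda>x. (x + y) mod 4) keranen_image"
  have sq': "square (shifted s) p0 p1 p2" using sq s(1) by (simp add: square_shifted)
  have len: "2 * p1 = p0 + p2" by (rule square_length[OF sq'])
  have "keranen m < 4" "keranen (Suc m) < 4" "keranen m \<noteq> keranen (Suc m)"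
    using keranen_less keranen_neq_Suc by auto
  then have "y \<noteq> 0"
    using s add_mod_4_cancel[of "keranen m" "keranen (Suc m)" s] by (auto simp: y_def shifted_def)
  then have y: "y \<in> {1, 2, 3}" using shifted_less[of s "Suc m"] unfolding y_def by force
  have letter: "shifted s (85 * m + i) = u ! i" if "i < 170" for i
  proof (cases "i < 85")
    case True
    then show ?thesis using shifted_rec[of i s m] s(2) keranen_image_less[of i] by (simp add: u_def nth_append)
  next
    case False
    then have "i - 85 < 85" "85 * m + i = 85 * Suc m + (i - 85)" using that by auto
    then show ?thesis using shifted_rec[of "i - 85" s "Suc m"] False by (simp add: u_def nth_append y_def)
  qed
  have length_u: "length u = 170" by (simp add: u_def)
  have factor: "map (shifted s) [85 * m..<85 * m + t] = take t u" if "t \<le> 170" for t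
    using that letter by (intro nth_equalityI) (simp_all add: length_u)
  have letter_count: "letter_count (shifted s) p c = letter_count (shifted s) (85 * m) c + int (count_list (take (p - 85 * m) u) c)"
    if "85 * m \<le> p" "p \<le> 85 * m + 170" for p c
    using letter_count_add[of "shifted s" "85 * m" "p - 85 * m" c] factor[of "p - 85 * m"] that by simp
  have "\<exists>c<4. 2 * int (count_list (take (p1 - 85 * m) u) c) \<noteq>
      int (count_list (take (p0 - 85 * m) u) c) + int (count_list (take (p2 - 85 * m) u) c)"
    using assms len by (intro no_square_images[OF y u_def]) auto
  then show False
    using sq' letter_count[of p0] letter_count[of p1] letter_count[of p2] assms len by (fastforce simp: square_def)
qed

text \<open>Descent on the last position. Either the rounded boundaries give a square that ends
  earlier, or they coincide, and then the three positions lie in the two images that meet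
  there.\<close>

theorem keranen_no_square:
  assumes "p0 < p1" shows "\<not> square keranen p0 p1 p2"
  using assms
proof (induction p2 arbitrary: p0 p1 rule: less_induct)
  case (less p2)
  show ?case
  proof
    assume sq: "square keranen p0 p1 p2"
    have len: "2 * p1 = p0 + p2" using sq square_length[of 0 p0 p1 p2] by (simp add: square_shifted)
    define q0 q1 q2 where q: "q0 = p0 div 85" "q1 = p1 div 85" "q2 = p2 div 85"
    have p: "p0 = 85 * q0 + p0 mod 85" "p1 = 85 * q1 + p1 mod 85" "p2 = 85 * q2 + p2 mod 85"
      by (auto simp: q)
    have le: "q0 \<le> q1" "q1 \<le> q2" using less.prems len by (auto simp: q intro!: div_le_mono)
    obtain a0 a1 a2 where a: "a0 \<le> 1" "a1 \<le> 1" "a2 \<le> 1"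
      and sq': "square keranen (q0 + a0) (q1 + a1) (q2 + a2)"
      using square_round[of q0 "p0 mod 85" q1 "p1 mod 85" q2 "p2 mod 85"] sq p by auto
    have len': "2 * (q1 + a1) = (q0 + a0) + (q2 + a2)"
      using sq' square_length[of 0 "q0 + a0" "q1 + a1" "q2 + a2"] by (simp add: square_shifted)
    show False
    proof (cases "q0 + a0 < q1 + a1")
      case True
      \<comment> \<open>For \<open>q2 = 0\<close> the boundaries would have to be \<open>0\<close>,
        \<open>1\<close>, \<open>2\<close>, out of reach of rounding up by at most one. Positivity
        of \<open>q2\<close> ensures \<open>q2 + a2 < p2\<close>.\<close>
      moreover have "0 < q2"
      proof (rule ccontr)
        assume "\<not> 0 < q2"
        then show False using True len' a le by simp
      qed
      then have "q2 + a2 < p2" using a(3) times_div_less_eq_dividend[of 85 p2] q(3) by linarith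
      ultimately show False using less.IH sq' by blast
    next
      case False
      then have "q0 + a0 = q1 + a1" "q2 + a2 = q1 + a1" using len' le a by presburger+
      moreover have "85 * q0 \<le> p0" "p2 < 85 * q2 + 85"
        using dividend_less_div_times[of 85 p2] by (simp_all add: q)
      \<comment> \<open>The two images are those of the letters at \<open>q1 + a1 - 1\<close> and
        \<open>q1 + a1\<close>. If the common boundary is \<open>0\<close>, truncated subtraction
        selects the first two images, which serve as well.\<close>
      moreover have "q1 + a1 - 1 \<le> q0" "q2 \<le> q1 + a1 - 1 + 1" using calculation(1,2) a by linarith+
      ultimately have "85 * (q1 + a1 - 1) \<le> p0" "p2 \<le> 85 * (q1 + a1 - 1) + 170" by linarith+
      then show False using no_square_near[OF less.prems, of "q1 + a1 - 1" p2] sq by simp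
    qed
  qed
qed

theorem keranen_no_anagram: "\<not> anagram (map keranen [i..<j])"
proof
  assume "anagram (map keranen [i..<j])"
  then obtain W P where WP: "map keranen [i..<j] = W @ P" "W \<noteq> []" "mset P = mset W"
    by (auto simp: anagram_def)
  define n where "n = length W"
  have "length P = n" using WP(3) by (simp add: n_def flip: size_mset)
  then have "j - i = n + n" using arg_cong[OF WP(1), of length] by (simp add: n_def)
  moreover have "0 < n" using WP(2) by (simp add: n_def)
  ultimately have j: "j = i + n + n" by linarith
  have "map keranen [i..<i + n] @ map keranen [i + n..<i + n + n] = W @ P"
    using WP(1) by (simp add: j flip: map_append upt_add_eq_append)
  then have W: "map keranen [i..<i + n] = W" and P: "map keranen [i + n..<i + n + n] = P"
    by (auto simp: n_def append_eq_append_conv)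
  have "square keranen i (i + n) (i + n + n)"
    using WP(3) letter_count_add[of keranen i n] letter_count_add[of keranen "i + n" n]
    by (simp add: square_def W P flip: count_mset)
  moreover have "i < i + n" using WP(2) by (simp add: n_def)
  ultimately show False using keranen_no_square by blast
qed

section \<open>Trees coloured along downward paths\<close>

lemma anagram_rev:
  assumes "anagram w" shows "anagram (rev w)"
proof -
  obtain W P where "w = W @ P" "W \<noteq> []" "mset P = mset W"
    using assms by (auto simp: anagram_def)
  then have "rev w = rev P @ rev W" "rev P \<noteq> []" "mset (rev W) = mset (rev P)"
    by auto
  then show ?thesis unfolding anagram_def by blast
qed

lemma anagram_filter:
  assumes "anagram w" "filter Q w \<noteq> []" shows "anagram (filter Q w)"
proof -
  obtain W P where w: "w = W @ P" and m: "mset P = mset W"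
    using assms by (auto simp: anagram_def)
  have "mset (filter Q P) = mset (filter Q W)" using m by simp
  moreover from this have "filter Q W \<noteq> []" using assms(2) w by (cases "filter Q W") auto
  ultimately show ?thesis unfolding anagram_def w filter_append by blast
qed

lemma anagram_map_inj:
  assumes "anagram (map f w)" "inj f" shows "anagram w"
proof -
  obtain W P where w: "map f w = W @ P" "W \<noteq> []" and m: "mset P = mset W"
    using assms by (auto simp: anagram_def)
  from w obtain W' P' where "w = W' @ P'" "W = map f W'" "P = map f P'"
    by (auto simp: map_eq_append_conv)
  moreover from this m have "image_mset f (mset P') = image_mset f (mset W')" by simp
  then have "mset P' = mset W'" using assms(2) by (metis multiset.inj_map_strong injD)
  ultimately show ?thesis using w(2) unfolding anagram_def by blast
qed

text \<open>After a step down, a step up would lead back to the parent just left. Vertices are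
  prepended one by one; \<open>xs\<close> is the climbing part read downwards.\<close>

lemma up_down_path:
  assumes "p \<noteq> []" "distinct p" "successively (\<lambda>x y. R x y \<or> R y x) p"
    and unique: "\<And>x x' y. R x y \<Longrightarrow> R x' y \<Longrightarrow> x = x'"
  shows "\<exists>xs u ys. p = rev xs @ u # ys \<and> successively R (u # xs) \<and> successively R (u # ys)"
  using assms(1-3)
proof (induction p rule: induct_list012)
  case (2 a)
  then show ?case by (intro exI[of _ "[]"]) auto
next
  case (3 a b p)
  then obtain xs u ys where IH: "b # p = rev xs @ u # ys" "successively R (u # xs)" "successively R (u # ys)"
    by auto
  have b: "b = last (u # xs)"
    using IH(1) by (cases xs rule: rev_cases) auto
  show ?case
  proof (cases "R b a")
    case True
    have "successively R (u # xs @ [a])"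
      using IH(2) True b by (metis append_Cons successively_append_iff successively.simps(2) list.sel(1) list.discI)
    then show ?thesis using IH by (intro exI[of _ "xs @ [a]"] exI[of _ u] exI[of _ ys]) auto
  next
    case False
    then have ab: "R a b" using 3 by auto
    show ?thesis
    proof (cases xs rule: rev_cases)
      case Nil
      then show ?thesis using IH ab by (intro exI[of _ "[]"] exI[of _ a] exI[of _ "b # p"]) auto
    next
      case (snoc zs z)
      then have "z = b" using b by auto
      \<comment> \<open>The path leaves \<open>b\<close> for a parent of \<open>b\<close>. By
        uniqueness this is \<open>a\<close>, which would then occur twice.\<close>
      have "R (last (u # zs)) b"
        using IH(2) unfolding snoc \<open>z = b\<close>
        by (metis append_Cons successively_append_iff list.sel(1) list.discI)
      then have "a = last (u # zs)" using ab unique by blast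
      then have "a \<in> set (u # zs)" by (metis last_in_set list.discI)
      then have "a \<in> set (b # p)" unfolding IH(1) snoc by auto
      then show ?thesis using 3 by auto
    qed
  qed
qed auto

text \<open>Meant for the first node \<open>x\<close> of an edge subdivided into \<open>n\<close>
  steps: the nodes of that edge share a side, and fewer than \<open>n\<close> nodes follow below
  it.\<close>

definition narrow :: "('v \<Rightarrow> 'v \<Rightarrow> bool) \<Rightarrow> ('v \<Rightarrow> bool) \<Rightarrow> nat \<Rightarrow> 'v \<Rightarrow> bool" where
  "narrow R side n x \<longleftrightarrow> (\<forall>zs. successively R (x # zs) \<longrightarrow>
     (\<forall>z \<in> set (take n (x # zs)). side z = side x) \<and> length (x # zs) < 2 * n)"

locale side_coloured_tree =
  fixes R :: "'v \<Rightarrow> 'v \<Rightarrow> bool" and side :: "'v \<Rightarrow> bool" and idx :: "bool \<Rightarrow> 'v \<Rightarrow> nat" and word :: "nat \<Rightarrow> nat"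
  assumes unique_parent: "R x y \<Longrightarrow> R x' y \<Longrightarrow> x = x'"
    and idx_child: "R x y \<Longrightarrow> idx s y = idx s x + of_bool (side y = s)"
    and siblings: "R u x \<Longrightarrow> R u y \<Longrightarrow> x \<noteq> y \<Longrightarrow> side x \<noteq> side y \<and> (\<exists>n. narrow R side n x \<and> narrow R side n y)"
    and word_less: "word n < 4"
    and word_no_anagram: "\<not> anagram (map word [i..<j])"
begin

definition colour :: "'v \<Rightarrow> nat" where
  "colour v = (if side v then word (idx True v) else 4 + word (idx False v))"

lemma colour_less: "colour v < 8"
  using word_less[of "idx True v"] word_less[of "idx False v"] by (simp add: colour_def)

lemma colour_class: "colour v < 4 \<longleftrightarrow> side v"
  using word_less[of "idx True v"] by (simp add: colour_def)

text \<open>\<open>idx s\<close> increases by one exactly on entering a node of side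
  \<open>s\<close>, so these nodes have consecutive indices. They start at \<open>idx s x\<close> if
  \<open>x\<close> itself is on side \<open>s\<close>, and one later otherwise.\<close>

lemma chain_side_indices:
  assumes "successively R (x # xs)"
  shows "map (idx s) (filter (\<lambda>v. side v = s) (x # xs)) =
    [idx s x + 1 - of_bool (side x = s)..<idx s (last (x # xs)) + 1]"
  using assms
proof (induction xs rule: rev_induct)
  case (snoc y ys)
  have *: "successively R (x # ys)" "R (last (x # ys)) y"
    using snoc.prems by (metis append_Cons successively_append_iff list.sel(1) list.discI)+
  have "idx s x \<le> idx s (last (x # ys))"
    using *(1)
  proof (induction ys rule: rev_induct)
    case (snoc z zs)
    then have "successively R (x # zs)" "R (last (x # zs)) z"
      by (metis append_Cons successively_append_iff list.sel(1) list.discI)+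
    then show ?case using snoc idx_child[of "last (x # zs)" z s] by auto
  qed auto
  then show ?case using snoc.IH[OF *(1)] idx_child[OF *(2), of s]
    by (auto simp: of_bool_def)
qed (auto simp: of_bool_def)

lemma filter_colour:
  "filter (\<lambda>c. (c < 4) = s) (map colour xs) =
    map (\<lambda>c. if s then c else 4 + c) (map word (map (idx s) (filter (\<lambda>v. side v = s) xs)))"
  by (induction xs) (auto simp: colour_class, auto simp: colour_def)

text \<open>The colours of side \<open>s\<close> inherit the anagram, and on a downward path they
  are a factor of \<open>word\<close>. Only the part of \<open>p\<close> on side \<open>s\<close>
  has to agree with a downward path, so \<open>p\<close> itself may bend.\<close>

lemma no_anagram_side:
  assumes "filter (\<lambda>v. side v = s) p = filter (\<lambda>v. side v = s) (x # xs)" "successively R (x # xs)"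
    and "\<exists>v \<in> set (x # xs). side v = s"
  shows "\<not> anagram (map colour p)"
proof
  assume "anagram (map colour p)"
  moreover have "filter (\<lambda>c. (c < 4) = s) (map colour p) \<noteq> []"
    unfolding filter_colour assms(1) using assms(3) by (auto simp: filter_empty_conv)
  ultimately have "anagram (filter (\<lambda>c. (c < 4) = s) (map colour p))"
    by (rule anagram_filter)
  then have "anagram (map word (map (idx s) (filter (\<lambda>v. side v = s) (x # xs))))"
    unfolding filter_colour assms(1) by (rule anagram_map_inj) (auto simp: inj_def)
  then show False unfolding chain_side_indices[OF assms(2)] using word_no_anagram by blast
qed

lemma no_anagram_chain:
  assumes "successively R (x # xs)" shows "\<not> anagram (map colour (x # xs))"
  by (rule no_anagram_side[where s = "side x", OF _ assms]) auto

text \<open>On the side of \<open>y\<close>, the path shows the same indices as the downward path from \<open>u\<close> through \<open>y\<close>.\<close>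

lemma no_anagram_bent_short:
  assumes xs: "successively R (u # x # xs)" and ys: "successively R (u # y # ys)"
    and "side x \<noteq> side y" "narrow R side n x" "length (x # xs) \<le> n"
  shows "\<not> anagram (map colour (rev (x # xs) @ u # y # ys))"
proof (rule no_anagram_side[where s = "side y", OF _ ys])
  have "\<forall>z \<in> set (x # xs). side z = side x"
    using assms by (auto simp: narrow_def)
  then have "filter (\<lambda>v. side v = side y) (rev (x # xs)) = []"
    using assms(3) unfolding filter_empty_conv set_rev by metis
  then show "filter (\<lambda>v. side v = side y) (rev (x # xs) @ u # y # ys) = filter (\<lambda>v. side v = side y) (u # y # ys)"
    by (simp only: filter_append append_Nil)
qed auto

text \<open>Count the nodes on the side of \<open>y\<close>: \<open>P\<close> contains the first
  \<open>n\<close> nodes of the branch of \<open>y\<close>, all on that side, whereas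
  \<open>W\<close> lies in the branch of \<open>x\<close>, where the first \<open>n\<close> nodes
  are on the other side and fewer than \<open>n\<close> remain.\<close>

lemma no_anagram_bent_long:
  assumes xs: "successively R (x # xs)" and ys: "successively R (y # ys)"
    and sd: "side x \<noteq> side y" and nx: "narrow R side n x" and ny: "narrow R side n y"
    and long: "n < length (x # xs)" "n < length (y # ys)"
    and split: "rev (x # xs) @ u # y # ys = W @ P" "length W \<le> length (x # xs)"
  shows "mset (map colour P) \<noteq> mset (map colour W)"
proof
  let ?Q = "\<lambda>v. side v = side y" and ?C = "\<lambda>c. (c < 4) = side y"
  assume "mset (map colour P) = mset (map colour W)"
  then have "size (filter_mset ?C (mset (map colour P))) = size (filter_mset ?C (mset (map colour W)))"
    by simp
  then have eq: "length (filter ?Q P) = length (filter ?Q W)"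
    by (simp only: mset_filter[symmetric] size_mset filter_map length_map comp_def colour_class)
  obtain us where us: "rev (x # xs) = W @ us" "P = us @ u # y # ys"
  proof -
    from split(1) obtain vs where
      "rev (x # xs) = W @ vs \<and> vs @ u # y # ys = P \<or> rev (x # xs) @ vs = W \<and> u # y # ys = vs @ P"
      unfolding append_eq_append_conv2 by blast
    then show ?thesis
    proof
      assume *: "rev (x # xs) @ vs = W \<and> u # y # ys = vs @ P"
      then have "length (rev (x # xs)) + length vs = length W" by (metis length_append)
      then have "length vs = 0" using split(2) unfolding length_rev by linarith
      then have "vs = []" by simp
      then show ?thesis using * that[of "[]"] by simp
    qed (use that[of vs] in simp)
  qed
  have take_n: "filter ?Q (take n (x # xs)) = []"
    using nx xs sd unfolding narrow_def filter_empty_conv by metis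
  have "n = length (filter ?Q (take n (y # ys)))"
    using ny ys long by (simp add: narrow_def filter_id_conv)
  also have "\<dots> \<le> length (filter ?Q (take n (y # ys) @ drop n (y # ys)))"
    unfolding filter_append by simp
  also have "\<dots> \<le> length (filter ?Q P)"
    unfolding us by simp
  also have "\<dots> = length (filter ?Q W)" by (rule eq)
  also have "\<dots> \<le> length (filter ?Q (rev (x # xs)))"
    unfolding us by simp
  also have "\<dots> = length (filter ?Q (take n (x # xs) @ drop n (x # xs)))"
    unfolding append_take_drop_id by (simp only: rev_filter[symmetric] length_rev)
  also have "\<dots> = length (filter ?Q (drop n (x # xs)))"
    unfolding filter_append take_n by simp
  also have "\<dots> \<le> length (x # xs) - n"
    by (metis length_drop length_filter_le)
  also have "\<dots> < n" using nx xs long by (auto simp: narrow_def)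
  finally show False by simp
qed

theorem no_anagram:
  assumes "p \<noteq> []" "distinct p" "successively (\<lambda>x y. R x y \<or> R y x) p"
  shows "\<not> anagram (map colour p)"
proof
  assume anagram: "anagram (map colour p)"
  obtain xs u ys where p: "p = rev xs @ u # ys" "successively R (u # xs)" "successively R (u # ys)"
    using up_down_path[where R = R, OF assms] unique_parent by metis
  have rev_p: "rev p = rev ys @ u # xs" using p(1) by simp
  have anagram': "anagram (map colour (rev p))"
    using anagram_rev[OF anagram] by (simp add: rev_map)
  show False
  proof (cases "xs = [] \<or> ys = []")
    case True
    then show False
      using no_anagram_chain[OF p(2)] no_anagram_chain[OF p(3)] anagram anagram' p(1) rev_p by auto
  next
    case False
    then obtain x xs' y ys' where xy: "xs = x # xs'" "ys = y # ys'" by (meson list.exhaust)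
    have R: "R u x" "R u y" using p xy by auto
    have chains: "successively R (x # xs')" "successively R (y # ys')" using p xy by auto
    have "x \<noteq> y" using p(1) assms(2) xy by auto
    then obtain n where n: "side x \<noteq> side y" "narrow R side n x" "narrow R side n y"
      using siblings[OF R] by blast
    \<comment> \<open>A short branch is excluded by \<open>no_anagram_bent_short\<close>, applied to
      \<open>p\<close> or to its reversal.\<close>
    have long: "n < length (x # xs')" "n < length (y # ys')"
      using no_anagram_bent_short[of u x xs' y ys' n] no_anagram_bent_short[of u y ys' x xs' n]
        n p xy anagram anagram' rev_p by (metis not_le)+
    obtain W P where WP: "map colour p = W @ P" "mset P = mset W"
      using anagram by (auto simp: anagram_def)
    then obtain W' P' where WP': "p = W' @ P'" "W = map colour W'" "P = map colour P'"
      by (auto simp: map_eq_append_conv)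
    show False
    proof (cases "length W' \<le> length xs")
      case True
      then show False
        using no_anagram_bent_long[OF chains n long, of u W' P'] WP WP' p(1) xy by auto
    next
      case False
      \<comment> \<open>Here the second half lies within the branch of \<open>y\<close>; reversal
        makes it the first half.\<close>
      have "rev (y # ys') @ u # x # xs' = rev P' @ rev W'"
        using p(1) WP'(1) rev_p xy by (metis rev_append)
      moreover have "length (rev P') \<le> length (y # ys')"
        using False xy arg_cong[OF trans[OF WP'(1)[symmetric] p(1)], of length] by simp
      moreover have "mset (map colour (rev W')) = mset (map colour (rev P'))"
        using WP WP' by (simp add: mset_map)
      ultimately show False
        using no_anagram_bent_long[OF chains(2,1) n(1)[symmetric] n(3,2) long(2,1)] by blast
    qed
  qed
qed

end

section \<open>Walks and paths as lists\<close>

lemma vwalk_iff_successively: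
  "vwalk p G \<longleftrightarrow> p \<noteq> [] \<and> set p \<subseteq> verts G \<and> successively (\<lambda>x y. (x, y) \<in> arcs_ends G) p"
proof -
  have "set (vwalk_arcs p) \<subseteq> arcs_ends G \<longleftrightarrow> successively (\<lambda>x y. (x, y) \<in> arcs_ends G) p"
    by (induction p rule: induct_list012) auto
  then show ?thesis by (auto simp: vwalk_def)
qed

lemma vpath_iff_successively:
  "vpath p (with_proj G) \<longleftrightarrow>
    p \<noteq> [] \<and> distinct p \<and> set p \<subseteq> pverts G \<and> successively (\<lambda>x y. (x, y) \<in> parcs G) p"
  by (auto simp: vpath_def vwalk_iff_successively)

section \<open>Parents in undirected trees\<close>

lemma length_vwalk_to_vpath_le: "length (vwalk_to_vpath p) \<le> length p"
proof (induction p rule: vwalk_to_vpath.induct)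
  case (2 x xs)
  then show ?case using length_dropWhile_le[of "\<lambda>y. y \<noteq> x" xs] by auto
qed simp

lemma distance_le:
  assumes "vwalk p (with_proj G)" "hd p = u" "last p = v"
  shows "distance G u v \<le> length p - 1"
proof -
  obtain q where q: "vpath q (with_proj G)" "hd q = u" "last q = v" "length q \<le> length p"
    using vwalk_to_vpath_vpath[OF assms(1)] vwalk_to_vpath_hd vwalk_to_vpath_last assms(2,3) 
      length_vwalk_to_vpath_le by metis
  have "distance G u v \<le> length q - 1"
    unfolding distance_def by (rule Least_le) (use q in \<open>auto simp: vwalk_length_simp\<close>)
  then show ?thesis using q(4) by simp
qed

locale rooted_tree_graph =
  fixes T :: "'a pair_pre_digraph" and r :: 'a
  assumes tree: "undirected_tree T" and root: "r \<in> pverts T"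
begin

sublocale pair_graph T
  using tree by (simp add: undirected_tree_def)

abbreviation d :: "'a \<Rightarrow> nat" where
  "d \<equiv> distance T r"

lemma ex_path:
  assumes "v \<in> pverts T" shows "\<exists>p. vpath p (with_proj T) \<and> hd p = r \<and> last p = v"
proof -
  have "connected (with_proj T)" using tree by (simp add: undirected_tree_def)
  then have "r \<rightarrow>\<^sup>*\<^bsub>mk_symmetric (with_proj T)\<^esub> v"
    using root assms by (auto simp: connected_def)
  then have "r \<rightarrow>\<^sup>*\<^bsub>with_proj T\<^esub> v"
    using reachable_mk_symmetric_eq[OF sym_arcs] by simp
  then show ?thesis
    using reachable_vwalk_conv vwalk_imp_ex_vpath by metis
qed

lemma ex_shortest:
  assumes "v \<in> pverts T"
  obtains p where "vpath p (with_proj T)" "hd p = r" "last p = v" "length p = Suc (d v)"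
proof -
  have "\<exists>n p. vpath p (with_proj T) \<and> hd p = r \<and> last p = v \<and> vwalk_length p = n"
    using ex_path[OF assms] by blast
  then have "\<exists>p. vpath p (with_proj T) \<and> hd p = r \<and> last p = v \<and> vwalk_length p = d v"
    unfolding distance_def by (rule LeastI_ex)
  then obtain p where p: "vpath p (with_proj T)" "hd p = r" "last p = v" "vwalk_length p = d v"
    by blast
  moreover have "p \<noteq> []" using p(1) by (auto simp: vpath_iff_successively)
  ultimately show ?thesis using that[of p] by (simp add: Suc_diff_le) (metis Suc_pred length_greater_0_conv)
qed

lemma distance_root: "d r = 0"
  using distance_le[of "[r]" T r r] root by (simp add: vwalk_iff_successively)

lemma distance_arc:
  assumes "(u, v) \<in> parcs T" shows "d v \<le> Suc (d u)"
proof -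
  have uv: "u \<in> pverts T" "v \<in> pverts T" using assms in_arcsD1 in_arcsD2 by blast+
  obtain p where p: "vpath p (with_proj T)" "hd p = r" "last p = u" "length p = Suc (d u)"
    using ex_shortest[OF uv(1)] .
  then have "vwalk (p @ [v]) (with_proj T)"
    using assms uv by (auto simp: vwalk_iff_successively vpath_iff_successively successively_append_iff)
  moreover have "hd (p @ [v]) = r" using p by (cases p) auto
  ultimately show ?thesis using distance_le[of "p @ [v]" T r v] p(4) by simp
qed

text \<open>Otherwise the part of the shortest path up to \<open>v\<close> would show that
  \<open>v\<close> is nearer to \<open>r\<close> than \<open>a\<close>.\<close>

lemma shortest_avoids:
  assumes "vpath p (with_proj T)" "hd p = r" "last p = a" "length p = Suc (d a)" "d a \<le> d v" "a \<noteq> v"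
  shows "v \<notin> set p"
proof
  assume "v \<in> set p"
  then obtain xs ys where xy: "p = xs @ v # ys" by (meson split_list)
  have "vwalk (xs @ [v]) (with_proj T)"
    using assms(1) unfolding xy by (auto simp: vwalk_iff_successively vpath_iff_successively successively_append_iff)
  moreover have "hd (xs @ [v]) = r" using assms(2) xy by (cases xs) auto
  ultimately have "d v \<le> length xs" using distance_le[of "xs @ [v]" T r v] by simp
  moreover have "ys \<noteq> []" using assms(3,6) xy by auto
  ultimately show False using assms(4,5) xy by (cases ys) auto
qed

text \<open>Shortest paths from \<open>r\<close> to \<open>a\<close> and \<open>b\<close> avoid
  \<open>v\<close>. Joined at \<open>r\<close> they contain a path from \<open>a\<close> to
  \<open>b\<close>, which \<open>v\<close> closes to a cycle. Equality of depths is allowed, which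
  later rules out edges within a level.\<close>

lemma unique_lower_neighbour:
  assumes a: "(v, a) \<in> parcs T" "d a \<le> d v" and b: "(v, b) \<in> parcs T" "d b \<le> d v"
  shows "a = b"
proof (rule ccontr)
  assume "a \<noteq> b"
  have verts: "a \<in> pverts T" "b \<in> pverts T" "v \<in> pverts T" using a b in_arcsD1 in_arcsD2 by blast+
  have neq: "a \<noteq> v" "b \<noteq> v" using a b no_loops' by blast+
  obtain p where p: "vpath p (with_proj T)" "hd p = r" "last p = a" "length p = Suc (d a)"
    using ex_shortest[OF verts(1)] .
  obtain q where q: "vpath q (with_proj T)" "hd q = r" "last q = b" "length q = Suc (d b)"
    using ex_shortest[OF verts(2)] .
  have avoid: "v \<notin> set p" "v \<notin> set q" using shortest_avoids p q a b neq by blast+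
  have ne: "p \<noteq> []" "q \<noteq> []" using p q by auto
  have sym: "(x, y) \<in> parcs T \<Longrightarrow> (y, x) \<in> parcs T" for x y by (rule arcs_symmetric)
  have "successively (\<lambda>x y. (x, y) \<in> parcs T) (rev p)"
    using p(1) sym unfolding successively_rev vpath_iff_successively
    by (auto elim!: successively_mono)
  \<comment> \<open>\<open>tl q\<close> avoids repeating the root, with which both paths
    begin.\<close>
  then have "vwalk (rev p @ tl q) (with_proj T)"
    using p q ne
    by (cases q) (auto simp: vwalk_iff_successively vpath_iff_successively successively_append_iff
        last_rev successively_Cons)
  moreover have "hd (rev p @ tl q) = a" "last (rev p @ tl q) = b"
    using p q ne \<open>a \<noteq> b\<close> by (auto simp: hd_append hd_rev last_append last_rev last_tl) (cases q; simp)+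
  ultimately obtain w where w: "vpath w (with_proj T)" "hd w = a" "last w = b" "set w \<subseteq> set (rev p @ tl q)"
    using vwalk_to_vpath_vpath vwalk_to_vpath_hd vwalk_to_vpath_last vwalk_to_vpath_subset by (metis subsetI)
  have "v \<notin> set w" using w(4) avoid ne list.set_sel(2)[of q v] by auto
  moreover have "w \<noteq> []" using w(1) by (auto simp: vpath_iff_successively)
  moreover have "2 \<le> length w"
    using w(2,3) \<open>a \<noteq> b\<close> \<open>w \<noteq> []\<close> by (cases w; cases "tl w") auto
  ultimately have "undirected_cycle T (v # w)"
    using w a(1) sym[OF b(1)] verts(3)
    by (auto simp: undirected_cycle_def vpath_iff_successively successively_Cons)
  then show False using tree by (auto simp: undirected_tree_def)
qed

lemma ex_parent:
  assumes "v \<in> pverts T" "v \<noteq> r"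
  shows "\<exists>u. (u, v) \<in> parcs T \<and> d v = Suc (d u)"
proof -
  obtain p where p: "vpath p (with_proj T)" "hd p = r" "last p = v" "length p = Suc (d v)"
    using ex_shortest[OF assms(1)] .
  define q where "q = butlast p"
  have "p \<noteq> []" using p(4) by auto
  then have p_eq: "p = q @ [v]" using p(3) by (simp add: q_def) (metis append_butlast_last_id)
  then have "q \<noteq> []" using p(2) assms(2) by auto
  then have q: "vwalk q (with_proj T)" "hd q = r" "(last q, v) \<in> parcs T"
    using p(1,2) unfolding p_eq
    by (auto simp: vwalk_iff_successively vpath_iff_successively successively_append_iff)
  have "d (last q) \<le> length q - 1" using distance_le[OF q(1,2) refl] .
  then have "Suc (d (last q)) \<le> d v" using p(4) \<open>q \<noteq> []\<close> p_eq by (cases q) auto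
  then show ?thesis using distance_arc[OF q(3)] q(3) by (intro exI[of _ "last q"]) auto
qed

definition par :: "'a \<Rightarrow> 'a" where
  "par v = (SOME u. (u, v) \<in> parcs T \<and> d v = Suc (d u))"

lemma
  assumes "v \<in> pverts T" "v \<noteq> r"
  shows par_arc: "(par v, v) \<in> parcs T" and distance_par: "d v = Suc (d (par v))"
    and par_in_verts: "par v \<in> pverts T"
  using someI_ex[OF ex_parent[OF assms]] in_arcsD1 unfolding par_def by blast+

text \<open>Of the two ends of an edge, the one that is not deeper is a lower neighbour of the
  other, and so is the parent of the other; by uniqueness they agree.\<close>

lemma arcs_eq:
  "parcs T = {(par v, v) | v. v \<in> pverts T - {r}} \<union> {(v, par v) | v. v \<in> pverts T - {r}}"
proof -
  have lower: "v \<noteq> r \<and> u = par v" if arc: "(u, v) \<in> parcs T" and le: "d u \<le> d v" for u v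
  proof -
    have v: "v \<in> pverts T" using arc in_arcsD2 by blast
    have "v \<noteq> r"
    proof
      assume "v = r"
      then have "d u = 0" using le distance_root by simp
      have u: "u \<in> pverts T" using arc in_arcsD1 by blast
      obtain p where p: "vpath p (with_proj T)" "hd p = r" "last p = u" "length p = Suc (d u)"
        using ex_shortest[OF u] .
      then have "u = r" using \<open>d u = 0\<close> by (cases p) auto
      then show False using arc \<open>v = r\<close> no_loops' by blast
    qed
    moreover have "u = par v"
      using unique_lower_neighbour[of v u "par v"] arcs_symmetric[OF arc] le
        arcs_symmetric[OF par_arc] distance_par v \<open>v \<noteq> r\<close> by auto
    ultimately show ?thesis by blast
  qed
  show ?thesis
  proof (intro set_eqI iffI)
    fix e assume e: "e \<in> parcs T"
    obtain u v where uv: "e = (u, v)" by (cases e)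
    then have "u \<in> pverts T" "v \<in> pverts T" using e in_arcsD1 in_arcsD2 by blast+
    then show "e \<in> {(par v, v) | v. v \<in> pverts T - {r}} \<union> {(v, par v) | v. v \<in> pverts T - {r}}"
      using lower[of u v] lower[of v u] e arcs_symmetric uv by (cases "d u \<le> d v") auto
  next
    fix e assume "e \<in> {(par v, v) | v. v \<in> pverts T - {r}} \<union> {(v, par v) | v. v \<in> pverts T - {r}}"
    then show "e \<in> parcs T" using par_arc arcs_symmetric by auto
  qed
qed

lemma siblings_in_children:
  assumes "v \<in> pverts T" "v \<noteq> r" shows "v \<in> children T r (par v)"
  using par_arc[OF assms] distance_par[OF assms] by (simp add: children_def)

lemma finite_children: "finite (children T r v)"
proof -
  have "children T r v \<subseteq> pverts T" using in_arcsD2 by (auto simp: children_def)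
  then show ?thesis using pair_finite_verts by (rule finite_subset)
qed

end

lemma ex_side:
  assumes "finite A" "card A \<le> 2" shows "\<exists>f :: 'a \<Rightarrow> bool. inj_on f A"
proof -
  have "card A \<le> card (UNIV :: bool set)" using assms(2) by (simp add: card_UNIV_bool)
  then show ?thesis using inj_on_iff_card_le[OF assms(1), of "UNIV :: bool set"] by auto
qed

section \<open>Subdivisions of rooted trees\<close>

text \<open>Parents and depths stand for the tree. \<open>enc\<close> numbers the vertices, so that
  division vertices can be named by natural numbers.\<close>

locale rooted_tree =
  fixes V :: "'a set" and r :: 'a and par :: "'a \<Rightarrow> 'a" and d :: "'a \<Rightarrow> nat" and enc :: "'a \<Rightarrow> nat"
  assumes finite_V: "finite V" and root: "r \<in> V" and depth_root: "d r = 0"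
    and par_in: "v \<in> V \<Longrightarrow> v \<noteq> r \<Longrightarrow> par v \<in> V"
    and depth_par: "v \<in> V \<Longrightarrow> v \<noteq> r \<Longrightarrow> d v = Suc (d (par v))"
    and inj_enc: "inj_on enc V"
begin

text \<open>
  The edge from \<open>par v\<close> to \<open>v\<close> becomes a path with \<open>L v\<close> edges, whose vertices after \<open>par v\<close> are the pairs
  \<open>(v, 1), \<dots>, (v, L v)\<close>; the last one represents \<open>v\<close> itself, and \<open>(r, 1)\<close> represents the root.
\<close>

definition lengths :: "('a \<Rightarrow> nat) \<Rightarrow> bool" where
  "lengths L \<longleftrightarrow> L r = 1 \<and> (\<forall>v \<in> V. 1 \<le> L v)"

definition nodes :: "('a \<Rightarrow> nat) \<Rightarrow> ('a \<times> nat) set" where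
  "nodes L = {(v, j). v \<in> V \<and> 1 \<le> j \<and> j \<le> L v}"

fun parent :: "('a \<Rightarrow> nat) \<Rightarrow> 'a \<times> nat \<Rightarrow> 'a \<times> nat \<Rightarrow> bool" where
  "parent L x (v, j) \<longleftrightarrow> v \<in> V \<and> 1 \<le> j \<and> j \<le> L v \<and> v \<noteq> r \<and>
    x = (if j = 1 then (par v, L (par v)) else (v, j - 1))"

fun emb :: "('a \<Rightarrow> nat) \<Rightarrow> 'a \<times> nat \<Rightarrow> 'a + nat" where
  "emb L (v, j) = (if j = L v then Inl v else Inr (prod_encode (enc v, j)))"

definition arcs_down :: "('a \<Rightarrow> nat) \<Rightarrow> ('a + nat) rel" where
  "arcs_down L = {(emb L x, emb L y) | x y. parent L x y}"

definition subdivided :: "('a \<Rightarrow> nat) \<Rightarrow> ('a + nat) pair_pre_digraph" where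
  "subdivided L = \<lparr>pverts = emb L ` nodes L, parcs = arcs_down L \<union> (arcs_down L)\<inverse>\<rparr>"

lemma parent_in_nodes:
  assumes "lengths L" "parent L x y" shows "x \<in> nodes L" "y \<in> nodes L"
  using assms par_in by (cases y; auto simp: nodes_def lengths_def split: if_splits)+

lemma parent_unique: "parent L x y \<Longrightarrow> parent L x' y \<Longrightarrow> x = x'"
  by (cases y) simp

lemma parent_less: "parent L (u, i) (v, j) \<Longrightarrow> d u < d v \<or> u = v \<and> i < j"
  using depth_par[of v] by (simp split: if_splits)

lemma parent_asym: "parent L x y \<Longrightarrow> \<not> parent L y x"
  using parent_less by (cases x; cases y) (metis less_asym less_irrefl)

lemma inj_emb: "inj_on (emb L) (nodes L)"
  using inj_enc by (auto simp: inj_on_def nodes_def split: if_splits)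

lemma emb_eq_iff: "x \<in> nodes L \<Longrightarrow> y \<in> nodes L \<Longrightarrow> emb L x = emb L y \<longleftrightarrow> x = y"
  using inj_emb by (auto simp: inj_on_def)

lemma par_neq: "v \<in> V \<Longrightarrow> v \<noteq> r \<Longrightarrow> par v \<noteq> v"
  using depth_par[of v] by auto

text \<open>Lengthening the edge above \<open>w\<close> divides its last arc. The end of the edge
  moves from \<open>(w, L w)\<close> to \<open>(w, Suc (L w))\<close>, as recorded by
  \<open>m\<close>, and the freed pair becomes the new vertex; embedded vertices keep their
  names.\<close>

lemma subdivided_Suc:
  assumes L: "lengths L" and w: "w \<in> V" "w \<noteq> r" and parent: "parent L x (w, L w)"
  defines "L' \<equiv> L(w := Suc (L w))"
  shows "subdivided L' = subdivide (subdivided L) (emb L x, emb L (w, L w)) (Inr (prod_encode (enc w, L w)))"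
proof -
  define m where "m y = (if y = (w, L w) then (w, Suc (L w)) else y)" for y
  let ?k = "L w" and ?N = "Inr (prod_encode (enc w, L w)) :: 'a + nat"
  have k: "1 \<le> ?k" using L w by (simp add: lengths_def)
  have m: "emb L' (m y) = emb L y" if "y \<in> nodes L" for y
    using that by (cases y) (auto simp: m_def L'_def nodes_def)
  have N: "emb L' (w, ?k) = ?N" by (simp add: L'_def)
  have nodes: "nodes L' = m ` nodes L \<union> {(w, ?k)}"
    using k w(1) by (auto simp: nodes_def L'_def m_def image_iff le_Suc_eq split: if_splits)
  have x: "x \<in> nodes L" "x \<noteq> (w, ?k)" "m x = x"
    using parent parent_in_nodes[OF L parent] parent_asym[OF parent] by (auto simp: m_def)
  have old: "(\<exists>y z. a = m y \<and> b = m z \<and> parent L y z \<and> z \<noteq> (w, ?k)) \<longleftrightarrow>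
      b \<noteq> (w, ?k) \<and> b \<noteq> (w, Suc ?k) \<and> (\<exists>y. a = m y \<and> parent L y b)" for a b
  proof
    assume "\<exists>y z. a = m y \<and> b = m z \<and> parent L y z \<and> z \<noteq> (w, ?k)"
    then obtain y z where yz: "a = m y" "b = m z" "parent L y z" "z \<noteq> (w, ?k)" by blast
    then have "b = z" by (simp add: m_def)
    moreover have "z \<noteq> (w, Suc ?k)" using yz(3) by auto
    ultimately show "b \<noteq> (w, ?k) \<and> b \<noteq> (w, Suc ?k) \<and> (\<exists>y. a = m y \<and> parent L y b)" using yz by blast
  next
    assume b: "b \<noteq> (w, ?k) \<and> b \<noteq> (w, Suc ?k) \<and> (\<exists>y. a = m y \<and> parent L y b)"
    then have "b = m b" by (simp add: m_def)
    then show "\<exists>y z. a = m y \<and> b = m z \<and> parent L y z \<and> z \<noteq> (w, ?k)" using b by blast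
  qed
  \<comment> \<open>The arc into the end of the edge is replaced by two arcs through the new
    node.\<close>
  have iff: "parent L' a b \<longleftrightarrow> (\<exists>y z. a = m y \<and> b = m z \<and> parent L y z \<and> z \<noteq> (w, ?k)) \<or>
      a = x \<and> b = (w, ?k) \<or> a = (w, ?k) \<and> b = m (w, ?k)" for a b
  proof (cases b)
    case (Pair v j)
    show ?thesis
    proof (cases "v = w")
      case True
      then show ?thesis
        unfolding old using parent k w par_neq[OF w] unfolding Pair L'_def m_def
        by (auto simp: le_Suc_eq)
    next
      case False
      then show ?thesis
        unfolding old unfolding Pair L'_def m_def by auto
    qed
  qed
  have "arcs_down L' = {(emb L' (m y), emb L' (m z)) | y z. parent L y z \<and> z \<noteq> (w, ?k)} \<union>
      {(emb L' x, emb L' (w, ?k)), (emb L' (w, ?k), emb L' (m (w, ?k)))}"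
    unfolding arcs_down_def iff by blast
  also have "{(emb L' (m y), emb L' (m z)) | y z. parent L y z \<and> z \<noteq> (w, ?k)} =
      {(emb L y, emb L z) | y z. parent L y z \<and> z \<noteq> (w, ?k)}"
    by (rule Collect_cong, intro ex_cong1, rule rev_conj_cong, rule refl)
      (metis m parent_in_nodes[OF L])
  also have "\<dots> = arcs_down L - {(emb L x, emb L (w, ?k))}"
  proof -
    have "z = (w, ?k)" if "parent L y z" "emb L z = emb L (w, ?k)" for y z
      using that emb_eq_iff parent_in_nodes(2)[OF L] parent by metis
    then have "(emb L y, emb L z) \<noteq> (emb L x, emb L (w, ?k)) \<longleftrightarrow> z \<noteq> (w, ?k)" if "parent L y z" for y z
      using that parent_unique[OF parent] by blast
    then show ?thesis unfolding arcs_down_def by (intro set_eqI) (simp only: mem_Collect_eq Diff_iff singleton_iff, metis)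
  qed
  also have "(emb L' x, emb L' (w, ?k)) = (emb L x, ?N)"
    using m[OF x(1)] N x(3) by simp
  also have "(emb L' (w, ?k), emb L' (m (w, ?k))) = (?N, emb L (w, ?k))"
    using m[OF parent_in_nodes(2)[OF L parent]] N by simp
  finally have down: "arcs_down L' = arcs_down L - {(emb L x, emb L (w, ?k))} \<union> {(emb L x, ?N), (?N, emb L (w, ?k))}" .
  have "(emb L (w, ?k), emb L x) \<notin> arcs_down L"
  proof
    assume "(emb L (w, ?k), emb L x) \<in> arcs_down L"
    then obtain y z where yz: "parent L y z" "emb L (w, ?k) = emb L y" "emb L x = emb L z"
      unfolding arcs_down_def by blast
    then have "y = (w, ?k)" "z = x"
      using emb_eq_iff parent_in_nodes[OF L] parent by metis+
    then show False using yz(1) parent parent_asym by blast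
  qed
  then have arcs: "parcs (subdivided L') = parcs (subdivided L) - {(emb L x, emb L (w, ?k)), (emb L (w, ?k), emb L x)} \<union>
      {(emb L x, ?N), (?N, emb L x), (?N, emb L (w, ?k)), (emb L (w, ?k), ?N)}"
    unfolding subdivided_def pair_pre_digraph.simps down by auto
  have verts: "pverts (subdivided L') = pverts (subdivided L) \<union> {?N}"
  proof -
    have "emb L' ` m ` nodes L = emb L ` nodes L"
      unfolding image_image using m by (intro image_cong) auto
    then show ?thesis
      by (simp only: subdivided_def pair_pre_digraph.simps nodes image_Un image_insert image_empty N)
  qed
  show ?thesis
    unfolding subdivide.simps arcs[symmetric] verts[symmetric] by simp
qed

text \<open>Induction on the number of division vertices, each step removing the last one of some
  edge.\<close>

lemma subdivision_pair_subdivided: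
  assumes "lengths L" "pair_bidirected_digraph (subdivided (\<lambda>_. 1))"
  shows "subdivision_pair (subdivided (\<lambda>_. 1)) (subdivided L)"
  using assms(1)
proof (induction "\<Sum>v\<in>V. L v - 1" arbitrary: L)
  case 0
  then have one: "L v = 1" if "v \<in> V" for v
    using finite_V that by (force simp: lengths_def)
  have nodes: "nodes L = nodes (\<lambda>_. 1)" using one by (auto simp: nodes_def)
  have emb: "emb L y = emb (\<lambda>_. 1) y" if "y \<in> nodes L" for y
    using that one by (cases y) (simp add: nodes_def)
  have "parent L y z \<longleftrightarrow> parent (\<lambda>_. 1) y z" for y z
    using one par_in by (cases z) auto
  then have "arcs_down L = arcs_down (\<lambda>_. 1)"
    unfolding arcs_down_def using emb parent_in_nodes[OF "0.prems"] by (metis (no_types, lifting))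
  then have "subdivided L = subdivided (\<lambda>_. 1)"
    unfolding subdivided_def nodes[symmetric] using emb by (simp cong: image_cong)
  then show ?case using assms(2) by (simp add: subdivision_pair_base)
next
  case (Suc n)
  have "\<exists>w \<in> V. L w - 1 \<noteq> 0"
  proof (rule ccontr)
    assume "\<not> ?thesis"
    then have "(\<Sum>v\<in>V. L v - 1) = 0" by (intro sum.neutral) blast
    then show False using Suc.hyps(2) by simp
  qed
  then obtain w where w: "w \<in> V" "2 \<le> L w" by auto
  define L0 where "L0 = L(w := L w - 1)"
  have "w \<noteq> r" using w Suc.prems by (auto simp: lengths_def)
  have L: "L = L0(w := Suc (L0 w))" using w by (auto simp: L0_def)
  have L0: "lengths L0" using w Suc.prems \<open>w \<noteq> r\<close> by (auto simp: lengths_def L0_def)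
  have "(\<Sum>v\<in>V. L v - 1) = Suc (\<Sum>v\<in>V. L0 v - 1)"
    using w finite_V by (simp add: L0_def sum.remove[of V w])
  then have IH: "subdivision_pair (subdivided (\<lambda>_. 1)) (subdivided L0)"
    using Suc L0 by simp
  obtain x where x: "parent L0 x (w, L0 w)"
    using w(1) \<open>w \<noteq> r\<close> L0 by (auto simp: lengths_def)
  show ?case
    unfolding L subdivided_Suc[OF L0 w(1) \<open>w \<noteq> r\<close> x]
  proof (rule subdivision_pair_divide[OF _ _ IH])
    show "(emb L0 x, emb L0 (w, L0 w)) \<in> parcs (subdivided L0)"
      using x by (auto simp: subdivided_def arcs_down_def)
    show "Inr (prod_encode (enc w, L0 w)) \<notin> pverts (subdivided L0)"
      using w(1) inj_enc by (auto simp: subdivided_def nodes_def inj_on_def split: if_splits)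
  qed
qed

lemma lengths_1: "lengths (\<lambda>_. 1)"
  by (simp add: lengths_def)

lemma pair_bidirected_subdivided:
  assumes "lengths L" shows "pair_bidirected_digraph (subdivided L)"
proof
  fix e assume "e \<in> parcs (subdivided L)"
  then obtain x y where xy: "parent L x y" "e = (emb L x, emb L y) \<or> e = (emb L y, emb L x)"
    unfolding subdivided_def arcs_down_def pair_pre_digraph.simps by blast
  have "emb L x \<noteq> emb L y"
    using emb_eq_iff parent_in_nodes[OF assms xy(1)] xy(1) parent_asym by blast
  then show "fst e \<in> pverts (subdivided L)" "snd e \<in> pverts (subdivided L)" "fst e \<noteq> snd e"
    using xy(2) parent_in_nodes[OF assms xy(1)] unfolding subdivided_def by force+
next
  show "symmetric (with_proj (subdivided L))"
    by (auto simp: symmetric_def sym_def subdivided_def)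
qed

lemma pverts_subdivided_1: "pverts (subdivided (\<lambda>_. 1)) = Inl ` V"
proof -
  have "nodes (\<lambda>_. 1) = (\<lambda>v. (v, 1)) ` V" by (auto simp: nodes_def)
  then show ?thesis by (simp add: subdivided_def image_image)
qed

lemma arcs_down_1: "arcs_down (\<lambda>_. 1) = {(Inl (par v), Inl v) | v. v \<in> V - {r}}"
proof -
  have "parent (\<lambda>_. 1) x y \<longleftrightarrow> (\<exists>v \<in> V - {r}. x = (par v, 1) \<and> y = (v, 1))" for x y
    by (cases y) auto
  then show ?thesis unfolding arcs_down_def by auto
qed

definition division_verts :: "('a \<Rightarrow> nat) \<Rightarrow> 'a \<Rightarrow> ('a + nat) list" where
  "division_verts L v = map (\<lambda>j. Inr (prod_encode (enc v, j))) [1..<L v]"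

lemma vpath_division_verts:
  assumes L: "lengths L" and v: "v \<in> V" "v \<noteq> r"
  shows "vpath (Inl (par v) # division_verts L v @ [Inl v]) (with_proj (subdivided L))"
proof -
  define xs where "xs = (par v, L (par v)) # map (Pair v) [1..<Suc (L v)]"
  have Lv: "1 \<le> L v" "1 \<le> L (par v)" using L v par_in by (auto simp: lengths_def)
  have map_xs: "map (emb L) xs = Inl (par v) # division_verts L v @ [Inl v]"
    using Lv by (simp add: xs_def division_verts_def)
  have nodes: "set xs \<subseteq> nodes L" using v par_in Lv by (auto simp: xs_def nodes_def)
  have "distinct xs" using par_neq[OF v] by (auto simp: xs_def distinct_map inj_on_def)
  then have "distinct (map (emb L) xs)"
    using inj_on_subset[OF inj_emb nodes] by (simp only: distinct_map)
  moreover have "successively (parent L) xs"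
  proof -
    have "parent L (xs ! i) (xs ! Suc i)" if "Suc i < length xs" for i
      using that v by (cases i) (simp_all add: xs_def del: upt_Suc)
    then show ?thesis by (simp add: successively_conv_nth)
  qed
  then have "successively (\<lambda>x y. (emb L x, emb L y) \<in> parcs (subdivided L)) xs"
    by (rule successively_mono) (auto simp: subdivided_def arcs_down_def simp del: emb.simps parent.simps)
  then have "successively (\<lambda>x y. (x, y) \<in> parcs (subdivided L)) (map (emb L) xs)"
    by (simp only: successively_map)
  moreover have "set (map (emb L) xs) \<subseteq> pverts (subdivided L)"
    using nodes unfolding subdivided_def pair_pre_digraph.simps set_map by (rule image_mono)
  ultimately show ?thesis
    unfolding map_xs vpath_iff_successively by blast
qed

lemma le_subdivision_subdivided:
  assumes L: "lengths L" and le: "\<And>v. v \<in> V \<Longrightarrow> v \<noteq> r \<Longrightarrow> L v \<le> Suc k"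
  shows "le_subdivision k (subdivided (\<lambda>_. 1)) (subdivided L)"
  unfolding le_subdivision_def
proof (intro conjI ballI)
  show "subdivision_pair (subdivided (\<lambda>_. 1)) (subdivided L)"
    by (rule subdivision_pair_subdivided[OF L pair_bidirected_subdivided[OF lengths_1]])
next
  fix e assume "e \<in> parcs (subdivided (\<lambda>_. 1))"
  then obtain v where v: "v \<in> V" "v \<noteq> r" and e: "e = (Inl (par v), Inl v) \<or> e = (Inl v, Inl (par v))"
    unfolding subdivided_def pair_pre_digraph.simps arcs_down_1 by auto
  let ?D = "division_verts L v"
  have path: "vpath (Inl (par v) # ?D @ [Inl v]) (with_proj (subdivided L))"
    by (rule vpath_division_verts[OF L v])
  have D: "set ?D \<inter> pverts (subdivided (\<lambda>_. 1)) = {}" "length ?D \<le> k"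
    using le[OF v] unfolding pverts_subdivided_1 by (auto simp: division_verts_def)
  have rev_path: "vpath (rev (Inl (par v) # ?D @ [Inl v])) (with_proj (subdivided L))"
    using path unfolding vpath_iff_successively successively_rev
    by (auto simp: subdivided_def elim!: successively_mono)
  show "case e of (u, w) \<Rightarrow> \<exists>ds. vpath (u # ds @ [w]) (with_proj (subdivided L)) \<and>
      set ds \<inter> pverts (subdivided (\<lambda>_. 1)) = {} \<and> length ds \<le> k"
    using e
  proof
    assume "e = (Inl (par v), Inl v)"
    then show ?thesis using D path by auto
  next
    assume "e = (Inl v, Inl (par v))"
    then show ?thesis using D rev_path by (auto intro!: exI[of _ "rev ?D"])
  qed
qed

section \<open>Colouring the subdivision\<close>

text \<open>The number of nodes of side \<open>s\<close> on the edges of the proper ancestors of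
  \<open>v\<close>, up to and including the root, which is reached after \<open>d v\<close>
  steps.\<close>

definition above :: "('a \<Rightarrow> nat) \<Rightarrow> ('a \<Rightarrow> bool) \<Rightarrow> bool \<Rightarrow> 'a \<Rightarrow> nat" where
  "above L side s v = (\<Sum>i<d v. if side ((par ^^ Suc i) v) = s then L ((par ^^ Suc i) v) else 0)"

lemma above_par:
  assumes "v \<in> V" "v \<noteq> r"
  shows "above L side s v = above L side s (par v) + (if side (par v) = s then L (par v) else 0)"
proof -
  have "(par ^^ Suc 0) v = par v" "(par ^^ Suc (Suc i)) v = (par ^^ Suc i) (par v)" for i
    by (simp_all add: funpow_swap1)
  then show ?thesis
    unfolding above_def depth_par[OF assms] sum.lessThan_Suc_shift by (simp only: add.commute)
qed

definition side_index :: "('a \<Rightarrow> nat) \<Rightarrow> ('a \<Rightarrow> bool) \<Rightarrow> bool \<Rightarrow> 'a \<times> nat \<Rightarrow> nat" where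
  "side_index L side s = (\<lambda>(v, j). above L side s v + (if side v = s then j else 0))"

lemma side_index_child:
  assumes "parent L x y"
  shows "side_index L side s y = side_index L side s x + of_bool (side (fst y) = s)"
  using assms above_par by (cases y) (auto simp: side_index_def split: if_splits)

definition edge_length :: "nat \<Rightarrow> 'a \<Rightarrow> nat" where
  "edge_length h v = (if v = r then 1 else 3 ^ (h - d v))"

lemma lengths_edge_length: "lengths (edge_length h)"
  by (simp add: lengths_def edge_length_def)

text \<open>Fewer than \<open>3 ^ (h - d v)\<close> nodes follow after the edge of \<open>v\<close>:
  the next edge takes a third of this number and, by induction, what lies below it less than a
  third.\<close>

lemma chain_length:
  assumes depth: "\<And>v. v \<in> V \<Longrightarrow> d v \<le> h"
    and "successively (parent (edge_length h)) ((v, j) # zs)" "j \<le> edge_length h v"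
  shows "j + length zs < edge_length h v + 3 ^ (h - d v)"
  using assms(2,3)
proof (induction zs arbitrary: v j)
  case (Cons z zs)
  obtain w i where z: "z = (w, i)" by (cases z)
  have p: "parent (edge_length h) (v, j) (w, i)" and chain: "successively (parent (edge_length h)) ((w, i) # zs)"
    using Cons.prems(1) z by auto
  have IH: "i + length zs < edge_length h w + 3 ^ (h - d w)"
    using Cons.IH[OF chain] p by simp
  show ?case
  proof (cases "i = 1")
    case True
    then have w: "w \<in> V" "w \<noteq> r" "v = par w" "j = edge_length h v" using p by auto
    have "h - d v = Suc (h - d w)" using depth[OF w(1)] depth_par[OF w(1,2)] w(3) by simp
    moreover have "edge_length h w = 3 ^ (h - d w)" using w by (simp add: edge_length_def)
    ultimately show ?thesis using IH w(4) True by simp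
  next
    case False
    then show ?thesis using IH p by auto
  qed
next
  case Nil
  have "(0::nat) < 3 ^ (h - d v)" by simp
  then have "j < edge_length h v + 3 ^ (h - d v)" using Nil.prems(2) by linarith
  then show ?case by simp
qed

lemma chain_in_edge:
  assumes "successively (parent L) ((v, j) # zs)" "(w, i) \<in> set (take n ((v, j) # zs))" "n + j \<le> Suc (L v)"
  shows "w = v"
  using assms
proof (induction zs arbitrary: j n)
  case (Cons z zs)
  obtain u k where z: "z = (u, k)" by (cases z)
  show ?case
  proof (cases "n \<le> 1")
    case True
    then show ?thesis using Cons.prems(2) by (cases n) auto
  next
    case False
    then obtain m where m: "n = Suc m" "1 \<le> m" by (cases n) auto
    have "j < L v" using Cons.prems(3) m by simp
    then have "z = (v, Suc j)" using Cons.prems(1) z by (auto split: if_splits)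
    then have chain: "successively (parent L) ((v, Suc j) # zs)" using Cons.prems(1) by simp
    have "(w, i) = (v, j) \<or> (w, i) \<in> set (take m ((v, Suc j) # zs))"
      using Cons.prems(2) \<open>z = (v, Suc j)\<close> m(1) by simp
    then show ?thesis
      using Cons.IH[OF chain] Cons.prems(3) m(1) by auto
  qed
next
  case Nil
  then show ?case by (cases n) auto
qed

lemma narrow_edge:
  fixes side :: "'a \<Rightarrow> bool"
  assumes "\<And>v. v \<in> V \<Longrightarrow> d v \<le> h" "v \<in> V" "v \<noteq> r"
  shows "narrow (parent (edge_length h)) (\<lambda>x. side (fst x)) (3 ^ (h - d v)) (v, 1)"
  unfolding narrow_def
proof (intro allI impI conjI ballI)
  fix zs assume chain: "successively (parent (edge_length h)) ((v, 1) # zs)"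
  have len: "edge_length h v = 3 ^ (h - d v)" using assms(3) by (simp add: edge_length_def)
  show "length ((v, 1) # zs) < 2 * 3 ^ (h - d v)"
    using chain_length[OF assms(1) chain] by (simp add: len)
  fix z assume "z \<in> set (take (3 ^ (h - d v)) ((v, 1) # zs))"
  then show "side (fst z) = side (fst (v, 1::nat))"
    using chain_in_edge[OF chain, of "fst z" "snd z"] len by auto
qed

lemma chromatic_number_subdivided:
  fixes side :: "'a \<Rightarrow> bool"
  assumes depth: "\<And>v. v \<in> V \<Longrightarrow> d v \<le> h"
    and side: "\<And>v w. v \<in> V \<Longrightarrow> w \<in> V \<Longrightarrow> v \<noteq> r \<Longrightarrow> w \<noteq> r \<Longrightarrow> par v = par w \<Longrightarrow> v \<noteq> w \<Longrightarrow> side v \<noteq> side w"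
  shows "anagram_free_chromatic_number (subdivided (edge_length h)) \<le> 8"
proof -
  let ?L = "edge_length h"
  interpret col: side_coloured_tree "parent ?L" "\<lambda>x. side (fst x)" "side_index ?L side" keranen
  proof
    show "parent ?L x y \<Longrightarrow> parent ?L x' y \<Longrightarrow> x = x'" for x x' y
      by (rule parent_unique)
    show "parent ?L x y \<Longrightarrow> side_index ?L side s y = side_index ?L side s x + of_bool (side (fst y) = s)" for x y s
      by (rule side_index_child)
    fix u x y assume px: "parent ?L u x" and py: "parent ?L u y" and neq: "x \<noteq> y"
    obtain v i w j where xy: "x = (v, i)" "y = (w, j)" by (cases x, cases y)
    \<comment> \<open>A node inside an edge has a single child, so distinct siblings are the first
      nodes of two edges below a common original vertex. These have equal length.\<close>
    have *: "v \<in> V" "v \<noteq> r" "w \<in> V" "w \<noteq> r" "i = 1 \<and> j = 1 \<and> par v = par w"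
      using px py neq unfolding xy by (auto split: if_splits)
    then have "d v = d w" using depth_par by simp
    then show "side (fst x) \<noteq> side (fst y) \<and> (\<exists>n. narrow (parent ?L) (\<lambda>x. side (fst x)) n x \<and>
        narrow (parent ?L) (\<lambda>x. side (fst x)) n y)"
      using narrow_edge[OF depth, of v side] narrow_edge[OF depth, of w side] side[of v w] * neq
      unfolding xy by auto
  qed (simp_all add: keranen_less keranen_no_anagram)
  define c where "c = col.colour \<circ> inv_into (nodes ?L) (emb ?L)"
  have "anagram_free_colouring (subdivided ?L) c"
    unfolding anagram_free_colouring_def
  proof (intro allI impI)
    fix p assume p: "vpath p (with_proj (subdivided ?L))"
    define q where "q = map (inv_into (nodes ?L) (emb ?L)) p"
    have "set p \<subseteq> emb ?L ` nodes ?L" using p by (auto simp: vpath_iff_successively subdivided_def)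
    then have p_eq: "p = map (emb ?L) q" and q: "set q \<subseteq> nodes ?L"
      unfolding q_def by (auto simp: map_idI f_inv_into_f inv_into_into subset_iff)
    have "q \<noteq> []" "distinct q"
      using p unfolding p_eq by (auto simp: vpath_iff_successively distinct_map)
    have "successively (\<lambda>x y. (emb ?L x, emb ?L y) \<in> parcs (subdivided ?L)) q"
      using p unfolding p_eq by (simp add: vpath_iff_successively successively_map)
    then have "successively (\<lambda>x y. parent ?L x y \<or> parent ?L y x) q"
    proof (rule successively_mono)
      fix x y assume xy: "x \<in> set q" "y \<in> set q" and "(emb ?L x, emb ?L y) \<in> parcs (subdivided ?L)"
      then obtain a b where ab: "parent ?L a b"
        "emb ?L x = emb ?L a \<and> emb ?L y = emb ?L b \<or> emb ?L x = emb ?L b \<and> emb ?L y = emb ?L a"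
        unfolding subdivided_def arcs_down_def pair_pre_digraph.simps by blast
      then show "parent ?L x y \<or> parent ?L y x"
        using emb_eq_iff parent_in_nodes[OF lengths_edge_length ab(1)] xy q by blast
    qed
    then have "\<not> anagram (map col.colour q)"
      using col.no_anagram \<open>q \<noteq> []\<close> \<open>distinct q\<close> by blast
    then show "\<not> anagram (map c p)" by (simp add: c_def q_def)
  qed
  moreover have "c ` pverts (subdivided ?L) \<subseteq> {..<8}"
    unfolding c_def by (intro image_subsetI) (simp only: lessThan_iff comp_def col.colour_less)
  ultimately show ?thesis
    unfolding anagram_free_chromatic_number_def by (intro Least_le) blast
qed

end

section \<open>Choice of sides and assembly\<close>

theorem theorem2:
  fixes h :: nat and T :: "'a pair_pre_digraph" and r :: 'a
  assumes "h \<ge> 1"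
    and "binary_tree T r"
    and "tree_height T r = h"
  shows "\<exists>S :: ('a + nat) pair_pre_digraph.
    le_subdivision (3 ^ (h - 1) - 1) (rename_verts Inl T) S \<and> anagram_free_chromatic_number S \<le> 8"
proof -
  interpret T: rooted_tree_graph T r
    using assms(2) by unfold_locales (auto simp: binary_tree_def)
  obtain enc :: "'a \<Rightarrow> nat" where enc: "inj_on enc (pverts T)"
    using finite_imp_inj_to_nat_seg[OF T.pair_finite_verts] by metis
  interpret S: rooted_tree "pverts T" r T.par T.d enc
    using T.pair_finite_verts T.root T.distance_root T.par_in_verts T.distance_par enc
    by unfold_locales auto
  have depth: "T.d v \<le> h" if "v \<in> pverts T" for v
    using assms(3) that T.pair_finite_verts by (auto simp: tree_height_def)
  have "\<exists>f :: 'a \<Rightarrow> bool. inj_on f (children T r u)" for u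
  proof (cases "u \<in> pverts T")
    case True
    then show ?thesis using assms(2) ex_side T.finite_children by (auto simp: binary_tree_def)
  next
    case False
    then have "children T r u = {}" using T.in_arcsD1 by (auto simp: children_def)
    then show ?thesis by simp
  qed
  then obtain f where f: "inj_on (f u :: 'a \<Rightarrow> bool) (children T r u)" for u
    by metis
  define side where "side v = f (T.par v) v" for v
  have side: "side v \<noteq> side w"
    if "v \<in> pverts T" "w \<in> pverts T" "v \<noteq> r" "w \<noteq> r" "T.par v = T.par w" "v \<noteq> w" for v w
    using that f[of "T.par v"] T.siblings_in_children[of v] T.siblings_in_children[of w]
    by (auto simp: side_def inj_on_def)
  \<comment> \<open>A vertex other than the root has positive depth, and an edge of \<open>n\<close>
    steps has \<open>n - 1\<close> division vertices.\<close>
  have "S.edge_length h v \<le> Suc (3 ^ (h - 1) - 1)" if "v \<in> pverts T" "v \<noteq> r" for v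
  proof -
    have "h - T.d v \<le> h - 1" using S.depth_par[OF that] by simp
    then have "(3::nat) ^ (h - T.d v) \<le> 3 ^ (h - 1)" by (intro power_increasing) auto
    then show ?thesis using that(2) by (simp add: S.edge_length_def)
  qed
  then have "le_subdivision (3 ^ (h - 1) - 1) (S.subdivided (\<lambda>_. 1)) (S.subdivided (S.edge_length h))"
    by (intro S.le_subdivision_subdivided S.lengths_edge_length)
  \<comment> \<open>With all lengths equal to \<open>1\<close>, every edge is a single step and
    \<open>T\<close> is recovered.\<close>
  moreover have "rename_verts Inl T = S.subdivided (\<lambda>_. 1)"
  proof -
    have "map_prod Inl Inl ` parcs T = S.arcs_down (\<lambda>_. 1) \<union> (S.arcs_down (\<lambda>_. 1))\<inverse>"
      unfolding T.arcs_eq S.arcs_down_1 by (auto simp: image_iff)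
    then show ?thesis
      using S.pverts_subdivided_1 by (simp add: rename_verts_def S.subdivided_def)
  qed
  moreover have "anagram_free_chromatic_number (S.subdivided (S.edge_length h)) \<le> 8"
    by (rule S.chromatic_number_subdivided[OF depth side])
  ultimately show ?thesis by auto
qed

end
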